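(* Let $\mathcal{X}$ be a finite field. For every $R>0$ there exists a sequence $\{(\Phi^{(n)},\Psi^{(n)})\}_{n=1}^{\infty}$, where for each $n$ the pair $(\Phi^{(n)},\Psi^{(n)})$ is a variable-length source encryption scheme of block length $n$ (the sequence not depending on $(p_X,p_K)$), such that for every $n\in\mathbb{N}$ and every $(p_X,p_K)\in\mathcal{P}(\mathcal{X})\times\mathcal{P}(\mathcal{X})$, $$\frac1n\overline{L}_{\Phi^{(n)}}\le R_n+\frac1n+(\log|\mathcal{X}|-R)(n+1)^{|\mathcal{X}|}2^{-nE(R|p_X)},$$ and $$\Delta_{\mathrm{MI}}^{(n)}(\Phi^{(n)}|p_X^n,p_K^n)=I(C^{(n)};\boldsymbol{X})\le\left\{n\left[E(R|p_X)+\log|\mathcal{X}|\right]+\log e\right\}(n+1)^{|\mathcal{X}|}2^{-nE(R|p_X)}+(R_n+1)|\mathcal{X}|(n+1)^{4|\mathcal{X}|}2^{-nF(R|p_K)}.$$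
   Context: All logarithms are to base 2, $\mathbb{N}=\{1,2,\ldots\}$, $e=2.718\ldots$, and $[a]^+:=\max\{0,a\}$. $\mathcal{P}(\mathcal{X})$ is the set of probability distributions on $\mathcal{X}$; $H(P)$ is Shannon entropy, $D(P\|Q)$ is relative entropy, and $I(\cdot;\cdot)$ is mutual information. Source and key: given $p_X,p_K\in\mathcal{P}(\mathcal{X})$, $\boldsymbol{X}=X_1\cdots X_n$ is i.i.d. with law $p_X$, $\boldsymbol{K}=K_1\cdots K_n$ is i.i.d. with law $p_K$, and $\boldsymbol{X}$ and $\boldsymbol{K}$ are independent; $p_X^n$ and $p_K^n$ denote the corresponding product laws on $\mathcal{X}^n$. Scheme: let $\mathcal{Y}=\{0,1\}$ and $\mathcal{Y}^*=\bigcup_{l\in\mathbb{N}}\mathcal{Y}^l$, and let $|y|$ be the length of $y\in\mathcal{Y}^*$. A variable-length source encryption scheme of block length $n$ is a pair of maps $\Phi^{(n)}:\mathcal{X}^n\times\mathcal{X}^n\to\mathcal{Y}^*$, $\Psi^{(n)}:\mathcal{X}^n\times\mathcal{Y}^*\to\mathcal{X}^n$, written $\Phi_{\boldsymbol{k}}^{(n)}(\boldsymbol{x})=\Phi^{(n)}(\boldsymbol{k},\boldsymbol{x})$ and $\Psi_{\boldsymbol{k}}^{(n)}(c)=\Psi^{(n)}(\boldsymbol{k},c)$, with $\Psi_{\boldsymbol{k}}^{(n)}(\Phi_{\boldsymbol{k}}^{(n)}(\boldsymbol{x}))=\boldsymbol{x}$ for all $\boldsymbol{k},\boldsymbol{x}\in\mathcal{X}^n$.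 The ciphertext is $C^{(n)}=\Phi_{\boldsymbol{K}}^{(n)}(\boldsymbol{X})$. The average codeword length is $\overline{L}_{\Phi^{(n)}}=\mathrm{E}\left[|\Phi_{\boldsymbol{K}}^{(n)}(\boldsymbol{X})|\right]=\sum_{\boldsymbol{k}}p_K^n(\boldsymbol{k})\,\mathrm{E}\left[|\Phi_{\boldsymbol{k}}^{(n)}(\boldsymbol{X})|\right]$. The security measure is $\Delta_{\mathrm{MI}}^{(n)}(\Phi^{(n)}|p_X^n,p_K^n)=I(C^{(n)};\boldsymbol{X})$. Exponents: for $R\ge0$, $$E(R|p_X)=\min_{P\in\mathcal{P}(\mathcal{X}):\,R\le H(P)}D(P\|p_X),\qquad F(R|p_K)=\min_{P\in\mathcal{P}(\mathcal{X})}\left\{[H(P)-R]^++D(P\|p_K)\right\}.$$ The minimum over an empty set is $+\infty$; if $E(R|p_X)=+\infty$, then $2^{-nE(R|p_X)}$ and $E(R|p_X)2^{-nE(R|p_X)}$ are read as $0$. Rate parameters: $\gamma_n=\frac1n\{|\mathcal{X}|\log(n+1)+\log|\mathcal{X}|\}$ and $R_n=R+\gamma_n$. *)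

theory Defs
  imports "HOL-Probability.Probability"
begin

text \<open>
  Probability distributions on a finite alphabet are elements of \<open>'a pmf\<close>; the block alphabet
  \<open>X^n\<close> is the set of lists of length \<open>n\<close>, and the product law \<open>p^n\<close> is \<open>replicate_pmf n p\<close>.
\<close>

definition shannon_entropy :: "'a pmf \<Rightarrow> real" where
  "shannon_entropy P = prob_space.entropy (measure_pmf P) 2 (count_space UNIV) (\<lambda>x. x)"

text \<open>
  \<open>relative_entropy P Q\<close> is \<open>D(P || Q)\<close>. The library's \<open>KL_divergence b M N\<close> takes the reference
  measure \<open>M\<close> first, and it is only meaningful if \<open>N\<close> is absolutely continuous with respect to \<open>M\<close>.
\<close>

definition relative_entropy :: "'a pmf \<Rightarrow> 'a pmf \<Rightarrow> ereal" where
  "relative_entropy P Q =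
     (if set_pmf P \<subseteq> set_pmf Q then ereal (KL_divergence 2 (measure_pmf Q) (measure_pmf P)) else \<infinity>)"

text \<open>
  In both exponents the minimum is written as an infimum in \<open>ereal\<close>. It is attained whenever the
  range of \<open>P\<close> is non-empty (compactness and lower semicontinuity), and it is \<open>\<infinity>\<close> otherwise.
\<close>

definition exponent_E :: "real \<Rightarrow> 'a::finite pmf \<Rightarrow> ereal" where
  "exponent_E R pX = (INF P \<in> {P. R \<le> shannon_entropy P}. relative_entropy P pX)"

definition exponent_F :: "real \<Rightarrow> 'a::finite pmf \<Rightarrow> ereal" where
  "exponent_F R pK = (INF P. ereal (max 0 (shannon_entropy P - R)) + relative_entropy P pK)"

text \<open>
  \<open>exp_decay n e\<close> is \<open>2^(- n e)\<close>, read as \<open>0\<close> for \<open>e = \<infinity>\<close>. Since \<open>real_of_ereal \<infinity> = 0\<close>, a product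
  \<open>real_of_ereal e * exp_decay n e\<close> is then \<open>0\<close> as well.
\<close>

definition exp_decay :: "nat \<Rightarrow> ereal \<Rightarrow> real" where
  "exp_decay n e = (if e = \<infinity> then 0 else 2 powr (- (real n * real_of_ereal e)))"

text \<open>
  Codewords are non-empty binary strings, because the union defining \<open>Y^*\<close> starts at length \<open>1\<close>.
  The key is the first argument of both maps, and only arguments of length \<open>n\<close> are constrained.
\<close>

definition encryption_scheme ::
  "nat \<Rightarrow> ('a list \<Rightarrow> 'a list \<Rightarrow> bool list) \<Rightarrow> ('a list \<Rightarrow> bool list \<Rightarrow> 'a list) \<Rightarrow> bool" where
  "encryption_scheme n \<phi> \<psi> \<longleftrightarrow>
     (\<forall>k x. length k = n \<and> length x = n \<longrightarrow> \<phi> k x \<noteq> []) \<and>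
     (\<forall>k c. length k = n \<and> c \<noteq> [] \<longrightarrow> length (\<psi> k c) = n) \<and>
     (\<forall>k x. length k = n \<and> length x = n \<longrightarrow> \<psi> k (\<phi> k x) = x)"

definition key_source_pmf :: "nat \<Rightarrow> 'a pmf \<Rightarrow> 'a pmf \<Rightarrow> ('a list \<times> 'a list) pmf" where
  "key_source_pmf n pX pK = pair_pmf (replicate_pmf n pK) (replicate_pmf n pX)"

definition avg_length ::
  "nat \<Rightarrow> ('a list \<Rightarrow> 'a list \<Rightarrow> bool list) \<Rightarrow> 'a pmf \<Rightarrow> 'a pmf \<Rightarrow> real" where
  "avg_length n \<phi> pX pK =
     measure_pmf.expectation (key_source_pmf n pX pK) (\<lambda>(k, x). real (length (\<phi> k x)))"

definition leakage_MI ::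
  "nat \<Rightarrow> ('a list \<Rightarrow> 'a list \<Rightarrow> bool list) \<Rightarrow> 'a pmf \<Rightarrow> 'a pmf \<Rightarrow> real" where
  "leakage_MI n \<phi> pX pK =
     prob_space.mutual_information (measure_pmf (key_source_pmf n pX pK)) 2
       (count_space UNIV) (count_space UNIV) (\<lambda>(k, x). \<phi> k x) (\<lambda>(k, x). x)"

text \<open>\<open>gamma_rate q n\<close> is \<open>\<gamma>_n\<close> for an alphabet with \<open>q\<close> elements.\<close>

definition gamma_rate :: "nat \<Rightarrow> nat \<Rightarrow> real" where
  "gamma_rate q n = (real q * log 2 (real n + 1) + log 2 (real q)) / real n"

text \<open>The measure-theoretic quantities above agree with the usual finite sums.\<close>

lemma KL_divergence_pmf:
  fixes p q :: "'a::countable pmf"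
  assumes "finite (set_pmf p)" "set_pmf p \<subseteq> set_pmf q"
  shows "KL_divergence 2 (measure_pmf q) (measure_pmf p) =
    (\<Sum>x\<in>set_pmf p. pmf p x * log 2 (pmf p x / pmf q x))"
proof -
  interpret sigma_finite_measure "count_space (UNIV :: 'a set)"
    by (rule sigma_finite_measure_count_space)
  have "KL_divergence 2 (measure_pmf q) (measure_pmf p) =
      KL_divergence 2 (density (count_space UNIV) (pmf q)) (density (count_space UNIV) (pmf p))"
    by (simp only: measure_pmf_eq_density)
  also have "\<dots> = (\<integral>x. pmf p x * log 2 (pmf p x / pmf q x) \<partial>count_space UNIV)"
    using assms(2) by (intro KL_density_density) (auto simp: AE_count_space set_pmf_eq)
  also have "\<dots> = (\<Sum>x\<in>set_pmf p. pmf p x * log 2 (pmf p x / pmf q x))"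
    using assms(1)
    by (subst lebesgue_integral_count_space_finite_support)
       (auto intro!: sum.mono_neutral_left finite_subset[OF _ assms(1)] simp: set_pmf_eq)
  finally show ?thesis .
qed

lemma shannon_entropy_eq:
  fixes P :: "'a::finite pmf"
  shows "shannon_entropy P = - (\<Sum>x\<in>UNIV. pmf P x * log 2 (pmf P x))"
proof -
  interpret sigma_finite_measure "count_space (UNIV :: 'a set)"
    by (rule sigma_finite_measure_count_space)
  have "distr (measure_pmf P) (count_space UNIV) (\<lambda>x. x) = measure_pmf P"
    by (rule distr_id2) simp
  then have "shannon_entropy P = - KL_divergence 2 (count_space UNIV) (measure_pmf P)"
    by (simp add: shannon_entropy_def prob_space.entropy_def[OF measure_pmf.prob_space_axioms])
  also have "KL_divergence 2 (count_space UNIV) (measure_pmf P) =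
      KL_divergence 2 (count_space UNIV) (density (count_space UNIV) (pmf P))"
    by (simp only: measure_pmf_eq_density)
  also have "\<dots> = (\<integral>x. pmf P x * log 2 (pmf P x) \<partial>count_space UNIV)"
    by (intro KL_density) auto
  also have "\<dots> = (\<Sum>x\<in>UNIV. pmf P x * log 2 (pmf P x))"
    by (simp add: lebesgue_integral_count_space_finite)
  finally show ?thesis .
qed

lemma relative_entropy_eq:
  fixes P Q :: "'a::finite pmf"
  shows "relative_entropy P Q =
    (if set_pmf P \<subseteq> set_pmf Q
     then ereal (\<Sum>x\<in>set_pmf P. pmf P x * log 2 (pmf P x / pmf Q x)) else \<infinity>)"
  by (simp add: relative_entropy_def KL_divergence_pmf)

lemma leakage_MI_eq:
  fixes \<phi> :: "'a::finite list \<Rightarrow> 'a list \<Rightarrow> bool list" and pX pK :: "'a pmf" and n :: nat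
  defines "J \<equiv> map_pmf (\<lambda>(k, x). (\<phi> k x, x)) (key_source_pmf n pX pK)"
  shows "leakage_MI n \<phi> pX pK =
    (\<Sum>(c, x)\<in>set_pmf J. pmf J (c, x) *
       log 2 (pmf J (c, x) / (pmf (map_pmf fst J) c * pmf (map_pmf snd J) x)))"
proof -
  let ?M = "measure_pmf (key_source_pmf n pX pK)"
  let ?A = "map_pmf fst J" and ?B = "map_pmf snd J"
  have UU: "count_space (UNIV :: bool list set) \<Otimes>\<^sub>M count_space (UNIV :: 'a list set) =
      count_space UNIV"
    by (subst pair_measure_countable) auto
  have A: "distr ?M (count_space UNIV) (\<lambda>(k, x). \<phi> k x) = measure_pmf ?A"
    by (simp add: J_def map_pmf_comp map_pmf_rep_eq[symmetric] case_prod_unfold)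
  have B: "distr ?M (count_space UNIV) (\<lambda>(k, x). x) = measure_pmf ?B"
    by (simp add: J_def map_pmf_comp map_pmf_rep_eq[symmetric] case_prod_unfold)
  have AJ: "distr ?M (count_space UNIV \<Otimes>\<^sub>M count_space UNIV)
      (\<lambda>z. ((\<lambda>(k, x). \<phi> k x) z, (\<lambda>(k, x). x) z)) = measure_pmf J"
    unfolding UU by (simp add: J_def map_pmf_rep_eq[symmetric] case_prod_unfold)
  have AB: "measure_pmf ?A \<Otimes>\<^sub>M measure_pmf ?B = measure_pmf (pair_pmf ?A ?B)"
  proof (rule measure_eqI_countable[where A = UNIV])
    show "sets (measure_pmf ?A \<Otimes>\<^sub>M measure_pmf ?B) = Pow UNIV"
      using UU by (metis sets_count_space sets_measure_pmf sets_measure_pmf_count_space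
          sets_pair_measure_cong)
    fix z :: "bool list \<times> 'a list"
    have "emeasure (measure_pmf ?A \<Otimes>\<^sub>M measure_pmf ?B) ({fst z} \<times> {snd z}) =
        emeasure (measure_pmf ?A) {fst z} * emeasure (measure_pmf ?B) {snd z}"
      by (rule measure_pmf.emeasure_pair_measure_Times) auto
    also have "\<dots> = emeasure (measure_pmf (pair_pmf ?A ?B)) {z}"
      by (cases z) (simp add: emeasure_pmf_single pmf_pair ennreal_mult)
    finally show "emeasure (measure_pmf ?A \<Otimes>\<^sub>M measure_pmf ?B) {z} =
        emeasure (measure_pmf (pair_pmf ?A ?B)) {z}"
      by (cases z) simp
  qed auto
  have fin: "finite (set_pmf J)"
  proof -
    have "finite {xs \<in> lists (set_pmf p). length xs = n}" for p :: "'a pmf"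
      by (rule finite_subset[OF _ finite_lists_length_eq[of UNIV n]]) auto
    then show ?thesis
      by (simp add: J_def key_source_pmf_def set_replicate_pmf)
  qed
  have "leakage_MI n \<phi> pX pK = KL_divergence 2 (measure_pmf (pair_pmf ?A ?B)) (measure_pmf J)"
    unfolding leakage_MI_def prob_space.mutual_information_def[OF measure_pmf.prob_space_axioms]
      A B AJ AB ..
  also have "\<dots> = (\<Sum>z\<in>set_pmf J. pmf J z * log 2 (pmf J z / pmf (pair_pmf ?A ?B) z))"
    using fin by (intro KL_divergence_pmf) force+
  finally show ?thesis
    by (simp add: split_beta pmf_pair[symmetric])
qed

end

theory Submission
  imports Defs
begin

text \<open>
  The scheme is explicit. Let \<open>S\<close> be the set of words whose type has
  entropy below \<open>R\<close> and \<open>N = card S\<close>, so \<open>N \<le> (n+1)^q * 2^(nR)\<close> for \<open>q\<close> the alphabet size. A word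
  in \<open>S\<close> is identified with a residue modulo \<open>N\<close> and masked by adding the rank of the key within its
  type class; any other word is sent in the clear, by a codeword of a different length. The clear words
  have probability at most \<open>(n+1)^q * 2^(-nE)\<close>.

  The mutual information is at most the averaged divergence of the channel outputs from any fixed
  distribution. Take the one giving the masked codewords total mass \<open>P(S)\<close> and the clear
  codewords total mass \<open>1 - P(S)\<close>, uniformly in each group: what remains is the binary entropy of the
  mode, \<open>n log q\<close> times the probability of a clear word, and the divergence of the reduced rank
  from uniform. Given its type \<open>P\<close>, the key is uniform on a class of about \<open>2^(nH(P))\<close> words, and
  reducing ranks modulo \<open>N\<close> is uniform up to a factor \<open>1 + N / 2^(nH(P))\<close>; convexity of \<open>t log t\<close>
  and the probability \<open>2^(-nD(P || p_K))\<close> of the class yield the exponent \<open>F\<close>.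
\<close>

section \<open>Logarithms, product laws and the two exponents\<close>

text \<open>The tangent at 1. It stands in for Jensen's inequality below: nonnegativity of
  divergence, the change of output law and the mixture over key types all come from it.\<close>

lemma log2_le: "0 < t \<Longrightarrow> log 2 t \<le> (t - 1) / ln 2" for t :: real
  using ln_le_minus_one[of t] by (simp add: log_def divide_right_mono)

lemma set_replicate_pmf_subset: "set_pmf (replicate_pmf n p) \<subseteq> {xs. length xs = n}"
  by (auto simp: set_replicate_pmf)

lemma finite_length_lists: "finite {xs :: 'a::finite list. length xs = n}"
  using finite_lists_length_eq[of "UNIV :: 'a set" n] by simp

lemma card_length_lists: "card {xs :: 'a::finite list. length xs = n} = CARD('a) ^ n"
  using card_lists_length_eq[of "UNIV :: 'a set" n] by simp

lemma pmf_replicate_pmf: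
  "pmf (replicate_pmf n p) xs = (if length xs = n then \<Prod>x\<leftarrow>xs. pmf p x else 0)"
proof (induction n arbitrary: xs)
  case 0
  then show ?case by (auto simp: pmf_return)
next
  case (Suc n)
  have rep: "replicate_pmf (Suc n) p = map_pmf (\<lambda>(x, xs). x # xs) (pair_pmf p (replicate_pmf n p))"
    by (simp add: pair_pmf_def map_bind_pmf)
  show ?case
  proof (cases xs)
    case Nil
    have "[] \<notin> set_pmf (replicate_pmf (Suc n) p)" by (auto simp: set_replicate_pmf)
    then show ?thesis using Nil by (simp add: set_pmf_eq)
  next
    case (Cons y ys)
    have "pmf (replicate_pmf (Suc n) p) ((\<lambda>(x, xs). x # xs) (y, ys)) =
        pmf (pair_pmf p (replicate_pmf n p)) (y, ys)"
      unfolding rep by (rule pmf_map_inj') (auto simp: inj_def)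
    then show ?thesis using Cons Suc.IH by (simp add: pmf_pair)
  qed
qed

lemma prod_list_count:
  fixes f :: "'a::finite \<Rightarrow> 'b::comm_monoid_mult"
  shows "(\<Prod>x\<leftarrow>xs. f x) = (\<Prod>a\<in>UNIV. f a ^ count (mset xs) a)"
proof (induction xs)
  case (Cons x xs)
  have "(\<Prod>a\<in>UNIV. f a ^ count (mset (x # xs)) a) =
     (\<Prod>a\<in>UNIV. (if a = x then f x else 1) * f a ^ count (mset xs) a)"
    by (intro prod.cong) auto
  with Cons show ?case by (simp add: prod.distrib)
qed simp

lemma sum_count: "(\<Sum>a\<in>UNIV. count A a) = size A" for A :: "'a::finite multiset"
  unfolding size_multiset_overloaded_eq
  by (rule sum.mono_neutral_right) (auto simp: count_eq_zero_iff)

text \<open>Gibbs' inequality: the tangent bound is summed over the support of \<open>P\<close>, on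
  which \<open>Q\<close> has mass at most 1.\<close>

lemma relative_entropy_nonneg: "0 \<le> relative_entropy P Q" for P Q :: "'a::finite pmf"
proof (cases "set_pmf P \<subseteq> set_pmf Q")
  case True
  have "- (pmf P x * log 2 (pmf P x / pmf Q x)) \<le> (pmf Q x - pmf P x) / ln 2"
    if "x \<in> set_pmf P" for x
  proof -
    have pos: "pmf P x > 0" "pmf Q x > 0" using that True by (auto simp: pmf_positive_iff)
    then have "- log 2 (pmf P x / pmf Q x) = log 2 (pmf Q x / pmf P x)"
      by (simp add: log_divide)
    also have "\<dots> \<le> (pmf Q x / pmf P x - 1) / ln 2" using pos by (intro log2_le) simp
    finally have "pmf P x * - log 2 (pmf P x / pmf Q x)
        \<le> pmf P x * ((pmf Q x / pmf P x - 1) / ln 2)"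
      using pos by (intro mult_left_mono) auto
    also have "\<dots> = (pmf Q x - pmf P x) / ln 2" using pos by (simp add: field_simps)
    finally show ?thesis by simp
  qed
  then have "(\<Sum>x\<in>set_pmf P. - (pmf P x * log 2 (pmf P x / pmf Q x))) \<le>
      (\<Sum>x\<in>set_pmf P. (pmf Q x - pmf P x) / ln 2)"
    by (rule sum_mono)
  also have "\<dots> = (sum (pmf Q) (set_pmf P) - sum (pmf P) (set_pmf P)) / ln 2"
    by (simp add: sum_subtractf flip: sum_divide_distrib)
  also have "sum (pmf P) (set_pmf P) = 1" by (rule sum_pmf_eq_1) auto
  also have "(sum (pmf Q) (set_pmf P) - 1) / ln 2 \<le> 0"
    using measure_pmf.prob_le_1[of Q "set_pmf P"]
    by (simp add: measure_measure_pmf_finite divide_nonpos_pos)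
  finally show ?thesis using True by (simp add: relative_entropy_eq sum_negf)
qed (simp add: relative_entropy_eq)

text \<open>The divergence from the uniform law is \<open>log 2 (CARD('a))\<close> minus the
  entropy.\<close>

lemma shannon_entropy_le_log_card: "shannon_entropy P \<le> log 2 (CARD('a))" for P :: "'a::finite pmf"
proof -
  have "0 \<le> relative_entropy P (pmf_of_set UNIV)" by (rule relative_entropy_nonneg)
  then have "0 \<le> (\<Sum>x\<in>set_pmf P. pmf P x * log 2 (pmf P x * CARD('a)))"
    by (simp add: relative_entropy_eq)
  also have "\<dots> = (\<Sum>x\<in>set_pmf P. pmf P x * log 2 (pmf P x) + pmf P x * log 2 (CARD('a)))"
    by (intro sum.cong refl) (simp add: log_mult pmf_positive_iff set_pmf_eq algebra_simps)
  also have "\<dots> = (\<Sum>x\<in>set_pmf P. pmf P x * log 2 (pmf P x)) + log 2 (CARD('a))"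
    by (simp add: sum.distrib sum_pmf_eq_1 flip: sum_distrib_right)
  also have "(\<Sum>x\<in>set_pmf P. pmf P x * log 2 (pmf P x)) = (\<Sum>x\<in>UNIV. pmf P x * log 2 (pmf P x))"
    by (rule sum.mono_neutral_left) (auto simp: set_pmf_eq)
  finally show ?thesis by (simp add: shannon_entropy_eq)
qed

lemma exponent_E_nonneg: "0 \<le> exponent_E R p"
  unfolding exponent_E_def by (intro INF_greatest relative_entropy_nonneg)

lemma exponent_F_nonneg: "0 \<le> exponent_F R p"
  unfolding exponent_F_def by (intro INF_greatest add_nonneg_nonneg relative_entropy_nonneg) (simp add: le_max_iff_disj)

text \<open>The condition \<open>0 \<le> d\<close> excludes minus infinity, which
  \<open>real_of_ereal\<close> sends to 0.\<close>

lemma exp_decay_antimono: "0 \<le> d \<Longrightarrow> d \<le> e \<Longrightarrow> exp_decay n e \<le> exp_decay n d"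
  by (cases d; cases e) (auto simp: exp_decay_def mult_left_mono)

lemma exp_decay_nonneg [simp]: "0 \<le> exp_decay n e"
  by (simp add: exp_decay_def)

lemma exp_decay_add: "exp_decay n (ereal a + e) = 2 powr (- (n * a)) * exp_decay n e" if "0 \<le> e"
  using that by (cases e) (auto simp: exp_decay_def powr_add[symmetric] algebra_simps)

subsection \<open>Types\<close>

text \<open>A type is represented by the multiset of letter counts, so the type class of \<open>A\<close> is
  \<open>permutations_of_multiset A\<close> and the type as a distribution is \<open>pmf_of_multiset A\<close>.\<close>

definition types_of_length :: "nat \<Rightarrow> 'a multiset set" where
  "types_of_length n = {A. size A = n}"

lemma inj_count: "inj count"
  by (simp add: inj_def multiset_eq_iff)

lemma count_types_subset:
  "count ` types_of_length n \<subseteq> (UNIV :: 'a::finite set) \<rightarrow>\<^sub>E {..n}"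
  by (auto simp: types_of_length_def count_le_size)

lemma finite_types_of_length [simp]: "finite (types_of_length n :: 'a::finite multiset set)"
  by (rule finite_imageD[OF finite_subset[OF count_types_subset] inj_on_subset[OF inj_count]])
     (auto intro: finite_PiE)

text \<open>Each of the \<open>CARD('a)\<close> counts lies between 0 and \<open>n\<close>.\<close>

lemma card_types_of_length: "card (types_of_length n :: 'a::finite multiset set)
    \<le> (n + 1) ^ CARD('a)"
proof -
  have "card (types_of_length n :: 'a multiset set)
      = card (count ` (types_of_length n :: 'a multiset set))"
    by (rule card_image[symmetric]) (rule inj_on_subset[OF inj_count], simp)
  also have "\<dots> \<le> card ((UNIV :: 'a set) \<rightarrow>\<^sub>E {..n})"
    by (intro card_mono count_types_subset finite_PiE) auto
  also have "\<dots> = (n + 1) ^ CARD('a)" by (simp add: card_PiE)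
  finally show ?thesis .
qed

text \<open>The log-likelihood of a word is \<open>n\<close> times the mean of
  \<open>log 2 (pmf p a)\<close> under its type, and this mean splits into minus entropy minus
  divergence. Hence all words of a type class are equally likely. If \<open>p\<close> misses a
  letter of \<open>A\<close>, the divergence is infinite and both sides are 0.\<close>

lemma pmf_replicate_type:
  fixes p :: "'a::finite pmf"
  assumes A: "A \<noteq> {#}" "mset xs = A"
  shows "pmf (replicate_pmf (size A) p) xs =
    exp_decay (size A) (ereal (shannon_entropy (pmf_of_multiset A))
        + relative_entropy (pmf_of_multiset A) p)"
proof (cases "set_mset A \<subseteq> set_pmf p")
  case False
  then have "xs \<notin> set_pmf (replicate_pmf (size A) p)" using A by (auto simp: set_replicate_pmf)
  then show ?thesis using False A by (simp add: set_pmf_iff relative_entropy_eq exp_decay_def)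
next
  case True
  let ?P = "pmf_of_multiset A" and ?n = "real (size A)"
  have n: "?n > 0" using A by (simp add: nonempty_has_size)
  have len: "length xs = size A" using A(2) by auto
  have S: "set_pmf ?P = set_mset A" "\<And>a. pmf ?P a = count A a / ?n"
    using A by simp_all
  have "(\<Prod>a\<in>UNIV. pmf p a ^ count A a) = (\<Prod>a\<in>set_mset A. pmf p a ^ count A a)"
    by (rule prod.mono_neutral_right) (auto simp: not_in_iff)
  also have "\<dots> = (\<Prod>a\<in>set_mset A. 2 powr (count A a * log 2 (pmf p a)))"
  proof (intro prod.cong refl)
    fix a assume "a \<in> set_mset A"
    then have "pmf p a > 0" using A True by (auto simp: pmf_positive_iff)
    then have "2 powr (count A a * log 2 (pmf p a)) = pmf p a powr count A a"
      by (simp add: powr_powr[symmetric] mult.commute[of "real _" "log _ _"])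
    then show "pmf p a ^ count A a = 2 powr (count A a * log 2 (pmf p a))"
      using \<open>pmf p a > 0\<close> by (simp add: powr_realpow)
  qed
  also have "\<dots> = 2 powr (\<Sum>a\<in>set_mset A. count A a * log 2 (pmf p a))"
    by (simp add: powr_sum)
  also have "(\<Sum>a\<in>set_mset A. count A a * log 2 (pmf p a)) =
     - (?n * (- (\<Sum>a\<in>set_mset A. pmf ?P a * log 2 (pmf ?P a)) +
      (\<Sum>a\<in>set_mset A. pmf ?P a * log 2 (pmf ?P a / pmf p a))))"
    unfolding sum_negf[symmetric] sum.distrib[symmetric] sum_distrib_left
  proof (intro sum.cong refl)
    fix a assume a: "a \<in> set_mset A"
    then have pos: "pmf p a > 0" "pmf ?P a > 0" using A True by (auto simp: pmf_positive_iff)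
    have "log 2 (pmf ?P a / pmf p a) = log 2 (pmf ?P a) - log 2 (pmf p a)"
      using pos by (simp add: log_divide)
    then have "- (?n * (- (pmf ?P a * log 2 (pmf ?P a)) + pmf ?P a * log 2 (pmf ?P a / pmf p a))) =
       ?n * pmf ?P a * log 2 (pmf p a)"
      by (simp only:) (simp add: algebra_simps del: pmf_of_multiset)
    also have "?n * pmf ?P a = count A a" using n A by simp
    finally show "count A a * log 2 (pmf p a) =
      - (?n * (- (pmf ?P a * log 2 (pmf ?P a)) + pmf ?P a * log 2 (pmf ?P a / pmf p a)))" ..
  qed
  also have "(\<Sum>a\<in>set_mset A. pmf ?P a * log 2 (pmf ?P a)) = (\<Sum>a\<in>UNIV. pmf ?P a * log 2 (pmf ?P a))"
    by (rule sum.mono_neutral_left) (auto simp: A count_eq_zero_iff)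
  finally show ?thesis using A True len
    by (simp add: pmf_replicate_pmf prod_list_count exp_decay_def relative_entropy_eq shannon_entropy_eq)
qed

lemma prob_type_class:
  fixes p :: "'a::finite pmf"
  assumes "A \<noteq> {#}"
  shows "measure_pmf.prob (replicate_pmf (size A) p) (permutations_of_multiset A) =
    card (permutations_of_multiset A) * exp_decay (size A)
      (ereal (shannon_entropy (pmf_of_multiset A)) + relative_entropy (pmf_of_multiset A) p)"
  by (simp add: measure_measure_pmf_finite permutations_of_multisetD
      pmf_replicate_type[OF assms])

lemma relative_entropy_self [simp]: "relative_entropy P P = 0" for P :: "'a::finite pmf"
  by (simp add: relative_entropy_eq pmf_positive_iff set_pmf_iff)

lemma prob_type_class_self:
  fixes A :: "'a::finite multiset"
  assumes "A \<noteq> {#}"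
  shows "measure_pmf.prob (replicate_pmf (size A) (pmf_of_multiset A)) (permutations_of_multiset A) =
    card (permutations_of_multiset A) * 2 powr (- (size A * shannon_entropy (pmf_of_multiset A)))"
  by (simp add: prob_type_class[OF assms] exp_decay_def)

text \<open>If letters follow the type itself, every word of the class has probability
  \<open>2 powr (- (n * H))\<close>, and these add up to at most 1.\<close>

lemma card_type_class_le:
  fixes A :: "'a::finite multiset"
  assumes "A \<noteq> {#}"
  shows "card (permutations_of_multiset A) \<le> 2 powr (size A * shannon_entropy (pmf_of_multiset A))"
proof -
  have "card (permutations_of_multiset A) * 2 powr (- (size A * shannon_entropy (pmf_of_multiset A)))
      \<le> 1"
    unfolding prob_type_class_self[OF assms, symmetric] by (rule measure_pmf.prob_le_1)
  then show ?thesis by (simp add: powr_minus field_simps)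
qed

text \<open>Passing from \<open>j\<close> to \<open>j + 1\<close> multiplies
  \<open>k ^ j / fact j\<close> by \<open>k / (j + 1)\<close>, so the maximum is at
  \<open>j = k\<close>. This is the one-letter factor in the comparison of multinomial
  probabilities.\<close>

lemma fact_mult_power_le: "fact k * k ^ j \<le> fact j * k ^ k" for j k :: nat
proof (cases "j \<le> k")
  case True
  have "fact k div fact (k - (k - j)) \<le> k ^ (k - j)" by (rule fact_div_fact_le_pow) simp
  then have "fact k \<le> fact j * k ^ (k - j)"
    using True fact_dvd[OF True] by (metis diff_diff_cancel dvd_mult_div_cancel mult_le_mono2)
  then have "fact k * k ^ j \<le> fact j * k ^ (k - j) * k ^ j" by (rule mult_le_mono1)
  then show ?thesis using True by (simp add: mult.assoc flip: power_add)
next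
  case False
  have *: "fact k * k ^ d \<le> fact (k + d)" for d
  proof (induction d)
    case (Suc d)
    have "fact k * k ^ Suc d \<le> k * fact (k + d)" using Suc by (simp add: mult.left_commute)
    also have "\<dots> \<le> Suc (k + d) * fact (k + d)" by (intro mult_right_mono) simp_all
    also have "\<dots> = fact (k + Suc d)" by simp
    finally show ?case .
  qed simp
  have "fact k * k ^ j = fact k * k ^ (j - k) * k ^ k"
    using False by (simp add: mult.assoc flip: power_add)
  also have "\<dots> \<le> fact j * k ^ k" using *[of "j - k"] False by (intro mult_le_mono1) simp
  finally show ?thesis .
qed

text \<open>Apart from a common constant, a multinomial class probability is a product over letters
  of powers divided by factorials, and \<open>fact_mult_power_le\<close> compares it letter by
  letter.\<close>

lemma prob_type_class_mode:
  fixes A B :: "'a::finite multiset"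
  assumes A: "A \<noteq> {#}" and AB: "size B = size A"
  shows "measure_pmf.prob (replicate_pmf (size A) (pmf_of_multiset A)) (permutations_of_multiset B) \<le>
    measure_pmf.prob (replicate_pmf (size A) (pmf_of_multiset A)) (permutations_of_multiset A)"
proof -
  let ?n = "size A"
  have n: "?n > 0" using A by (simp add: nonempty_has_size)
  \<comment> \<open>The multinomial formula, with the factorials and \<open>?n ^ ?n\<close> moved
    out of the denominators.\<close>
  have eq: "measure_pmf.prob (replicate_pmf ?n (pmf_of_multiset A)) (permutations_of_multiset C)
      * real (\<Prod>a\<in>UNIV. fact (count C a)) * ?n ^ ?n =
      fact ?n * real (\<Prod>a\<in>UNIV. count A a ^ count C a)" if C: "size C = ?n" for C
  proof -
    have len: "length xs = ?n" if "xs \<in> permutations_of_multiset C" for xs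
      using that C by (auto simp: length_finite_permutations_of_multiset)
    have "(\<Prod>a\<in>set_mset C. fact (count C a)) = (\<Prod>a\<in>UNIV. fact (count C a) :: nat)"
      by (rule prod.mono_neutral_left) (auto simp: not_in_iff)
    then have "card (permutations_of_multiset C) * (\<Prod>a\<in>UNIV. fact (count C a)) = fact ?n"
      using card_permutations_of_multiset_aux[of C] C by simp
    then have c: "card (permutations_of_multiset C) * real (\<Prod>a\<in>UNIV. fact (count C a)) = fact ?n"
      by (metis of_nat_fact of_nat_mult)
    have pw: "(\<Prod>a\<in>UNIV. (count A a / ?n) ^ count C a) * ?n ^ ?n
        = real (\<Prod>a\<in>UNIV. count A a ^ count C a)"
      using A C by (simp add: power_divide prod_dividef sum_count flip: power_sum)
    have "measure_pmf.prob (replicate_pmf ?n (pmf_of_multiset A)) (permutations_of_multiset C) =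
        (\<Sum>xs\<in>permutations_of_multiset C. \<Prod>a\<in>UNIV. (count A a / ?n) ^ count C a)"
      using len A by (auto simp: measure_measure_pmf_finite pmf_replicate_pmf prod_list_count permutations_of_multisetD intro!: sum.cong)
    also have "\<dots> = card (permutations_of_multiset C) * (\<Prod>a\<in>UNIV. (count A a / ?n) ^ count C a)"
      by simp
    finally have "measure_pmf.prob (replicate_pmf ?n (pmf_of_multiset A)) (permutations_of_multiset C) *
        real (\<Prod>a\<in>UNIV. fact (count C a)) * ?n ^ ?n =
        (card (permutations_of_multiset C) * real (\<Prod>a\<in>UNIV. fact (count C a))) *
        ((\<Prod>a\<in>UNIV. (count A a / ?n) ^ count C a) * ?n ^ ?n)"
      by (simp only: mult_ac)
    then show ?thesis by (simp only: c pw)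
  qed
  let ?p = "\<lambda>C. measure_pmf.prob (replicate_pmf ?n (pmf_of_multiset A)) (permutations_of_multiset C)"
  let ?f = "\<lambda>C. \<Prod>a\<in>UNIV. fact (count C a) :: nat"
  let ?g = "\<lambda>C. \<Prod>a\<in>UNIV. count A a ^ count C a"
  have pos: "real (?f C) > 0" for C :: "'a multiset" by (simp add: prod_pos)
  have "?f A * ?g B \<le> ?f B * ?g A"
    unfolding prod.distrib[symmetric] by (intro prod_mono conjI fact_mult_power_le) auto
  then have le: "real (?f A) * real (?g B) \<le> real (?f B) * real (?g A)"
    by (metis of_nat_le_iff of_nat_mult)
  have "(?p B * (real (?f B) * real (?f A))) * ?n ^ ?n = fact ?n * (real (?f A) * real (?g B))"
    using arg_cong[OF eq[OF AB], of "\<lambda>t. t * real (?f A)"] by (simp only: mult_ac)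
  also have "\<dots> \<le> fact ?n * (real (?f B) * real (?g A))"
    by (intro mult_left_mono le) simp
  also have "\<dots> = (?p A * (real (?f B) * real (?f A))) * ?n ^ ?n"
    using arg_cong[OF eq[OF refl], of "\<lambda>t. t * real (?f B)"] by (simp only: mult_ac)
  finally have "?p B * (real (?f B) * real (?f A)) \<le> ?p A * (real (?f B) * real (?f A))"
    using n by (simp only: mult_le_cancel_right) auto
  then show ?thesis using pos[of A] pos[of B] by (simp only: mult_le_cancel_right)
      (auto simp: zero_less_mult_iff)
qed

lemma prob_eq_sum_types:
  fixes p :: "'a::finite pmf"
  shows "measure_pmf.prob (replicate_pmf n p) {xs. Q xs} =
    (\<Sum>A\<in>types_of_length n.
        measure_pmf.prob (replicate_pmf n p) {xs \<in> permutations_of_multiset A. Q xs})"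
proof -
  have "measure_pmf.prob (replicate_pmf n p) {xs. Q xs} =
      measure_pmf.prob (replicate_pmf n p) (\<Union>A\<in>types_of_length n. {xs \<in> permutations_of_multiset A. Q xs})"
    by (intro measure_eq_AE) (auto simp: AE_measure_pmf_iff set_replicate_pmf types_of_length_def permutations_of_multiset_def)
  also have "\<dots> = (\<Sum>A\<in>types_of_length n.
      measure_pmf.prob (replicate_pmf n p) {xs \<in> permutations_of_multiset A. Q xs})"
    by (intro measure_pmf.finite_measure_finite_Union)
        (auto simp: disjoint_family_on_def permutations_of_multiset_def)
  finally show ?thesis .
qed

lemma sum_prob_types:
  fixes p :: "'a::finite pmf"
  shows "(\<Sum>A\<in>types_of_length n. measure_pmf.prob (replicate_pmf n p) (permutations_of_multiset A))
      = 1"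
  using prob_eq_sum_types[of n p "\<lambda>_. True"] by simp

text \<open>There are polynomially many types, so a sum over them costs only this factor.\<close>

lemma sum_types_le:
  assumes "\<And>A. A \<in> types_of_length n \<Longrightarrow> f A \<le> c" "0 \<le> c"
  shows "(\<Sum>A\<in>types_of_length n. f (A :: 'a::finite multiset)) \<le> (real n + 1) ^ CARD('a) * c"
proof -
  have "(\<Sum>A\<in>types_of_length n. f (A :: 'a multiset))
      \<le> real (card (types_of_length n :: 'a multiset set)) * c"
    by (rule sum_bounded_above) (rule assms)
  also have "\<dots> \<le> real ((n + 1) ^ CARD('a)) * c"
    by (intro mult_right_mono of_nat_mono card_types_of_length assms)
  finally show ?thesis by (simp add: add.commute)
qed

text \<open>Under its own type the class of \<open>A\<close> is the likeliest of at most
  \<open>(n + 1) ^ CARD('a)\<close> classes, so its probability is at least the reciprocal of that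
  number. Dividing by the common probability of its words yields its size.\<close>

lemma card_type_class_ge:
  fixes A :: "'a::finite multiset"
  assumes "A \<noteq> {#}"
  shows "2 powr (size A * shannon_entropy (pmf_of_multiset A)) \<le>
    (real (size A) + 1) ^ CARD('a) * card (permutations_of_multiset A)"
proof -
  let ?p = "\<lambda>C. measure_pmf.prob (replicate_pmf (size A) (pmf_of_multiset A)) (permutations_of_multiset C)"
  have "1 = (\<Sum>C\<in>types_of_length (size A). ?p C)" by (simp add: sum_prob_types)
  also have "\<dots> \<le> (real (size A) + 1) ^ CARD('a) * ?p A"
    by (intro sum_types_le prob_type_class_mode assms) (auto simp: types_of_length_def)
  finally show ?thesis using prob_type_class_self[OF assms] by (simp add: powr_minus field_simps)
qed

text \<open>The upper bound on the class size cancels the entropy part of the word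
  probability.\<close>

lemma prob_type_class_le:
  fixes p :: "'a::finite pmf"
  assumes "A \<noteq> {#}"
  shows "measure_pmf.prob (replicate_pmf (size A) p) (permutations_of_multiset A) \<le>
    exp_decay (size A) (relative_entropy (pmf_of_multiset A) p)"
proof -
  let ?x = "size A * shannon_entropy (pmf_of_multiset A)"
  let ?d = "exp_decay (size A) (relative_entropy (pmf_of_multiset A) p)"
  have "measure_pmf.prob (replicate_pmf (size A) p) (permutations_of_multiset A) =
      card (permutations_of_multiset A) * (2 powr (- ?x) * ?d)"
    by (simp add: prob_type_class[OF assms] exp_decay_add relative_entropy_nonneg)
  also have "\<dots> \<le> 2 powr ?x * (2 powr (- ?x) * ?d)"
    by (intro mult_right_mono card_type_class_le assms) simp
  also have "\<dots> = ?d" by (simp add: powr_minus)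
  finally show ?thesis .
qed

section \<open>The masked words and the probability of the others\<close>

text \<open>With the strict inequality, the types left out for \<open>n > 0\<close> are those with
  \<open>R \<le> shannon_entropy P\<close>, as in the range of \<open>exponent_E\<close>.\<close>

definition low_entropy_words :: "nat \<Rightarrow> real \<Rightarrow> 'a list set" where
  "low_entropy_words n R = {xs. length xs = n \<and> shannon_entropy (pmf_of_multiset (mset xs)) < R}"

lemma card_low_entropy_words_le:
  assumes "n > 0"
  shows "card (low_entropy_words n R :: 'a::finite list set)
      \<le> (real n + 1) ^ CARD('a) * 2 powr (n * R)"
proof -
  let ?T = "{A \<in> types_of_length n. shannon_entropy (pmf_of_multiset (A :: 'a multiset)) < R}"
  have "low_entropy_words n R = (\<Union>A\<in>?T. permutations_of_multiset A)"
    by (auto simp: low_entropy_words_def types_of_length_def permutations_of_multiset_def)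
  then have "card (low_entropy_words n R :: 'a list set)
      \<le> (\<Sum>A\<in>?T. card (permutations_of_multiset A))"
    by (simp add: card_UN_le)
  then have "real (card (low_entropy_words n R :: 'a list set))
      \<le> (\<Sum>A\<in>?T. real (card (permutations_of_multiset A)))"
    by (metis of_nat_le_iff of_nat_sum)
  also have "\<dots> = (\<Sum>A\<in>types_of_length n. if shannon_entropy (pmf_of_multiset (A :: 'a multiset)) < R
      then real (card (permutations_of_multiset A)) else 0)"
    by (simp add: sum.inter_filter)
  also have "\<dots> \<le> (real n + 1) ^ CARD('a) * 2 powr (n * R)"
  proof (intro sum_types_le)
    fix A :: "'a multiset" assume "A \<in> types_of_length n"
    then have A: "A \<noteq> {#}" "size A = n" using assms by (auto simp: types_of_length_def)
    show "(if shannon_entropy (pmf_of_multiset A) < R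
        then real (card (permutations_of_multiset A)) else 0) \<le> 2 powr (n * R)"
    proof (cases "shannon_entropy (pmf_of_multiset A) < R")
      case True
      have "real (card (permutations_of_multiset A))
          \<le> 2 powr (n * shannon_entropy (pmf_of_multiset A))"
        using card_type_class_le[OF A(1)] A(2) by simp
      also have "\<dots> \<le> 2 powr (n * R)" using True by (simp add: mult_left_mono)
      finally show ?thesis using True by simp
    qed simp
  qed simp
  finally show ?thesis .
qed

text \<open>The type of an excluded word is admissible in \<open>exponent_E\<close>, so its
  divergence from \<open>p\<close> is at least the infimum; the sum over types adds the polynomial
  factor.\<close>

lemma prob_high_entropy_le:
  fixes p :: "'a::finite pmf"
  assumes "n > 0"
  shows "measure_pmf.prob (replicate_pmf n p) (- low_entropy_words n R) \<le>
    (real n + 1) ^ CARD('a) * exp_decay n (exponent_E R p)"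
proof -
  have "measure_pmf.prob (replicate_pmf n p) (- low_entropy_words n R) =
      (\<Sum>A\<in>types_of_length n.
          measure_pmf.prob (replicate_pmf n p) {xs \<in> permutations_of_multiset A. xs \<in> - low_entropy_words n R})"
    using prob_eq_sum_types[of n p "\<lambda>xs. xs \<in> - low_entropy_words n R"] by (simp add: Compl_eq)
  also have "\<dots> \<le> (real n + 1) ^ CARD('a) * exp_decay n (exponent_E R p)"
  proof (intro sum_types_le)
    fix A :: "'a multiset" assume "A \<in> types_of_length n"
    then have A: "A \<noteq> {#}" "size A = n" using assms by (auto simp: types_of_length_def)
    show "measure_pmf.prob (replicate_pmf n p) {xs \<in> permutations_of_multiset A.
        xs \<in> - low_entropy_words n R} \<le>
      exp_decay n (exponent_E R p)"
    proof (cases "shannon_entropy (pmf_of_multiset A) < R")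
      case True
      then have "{xs \<in> permutations_of_multiset A. xs \<in> - low_entropy_words n R} = {}"
        using A by (auto simp: low_entropy_words_def permutations_of_multiset_def)
      then show ?thesis by (simp only: measure_empty exp_decay_nonneg)
    next
      case False
      have "measure_pmf.prob (replicate_pmf n p) {xs \<in> permutations_of_multiset A.
          xs \<in> - low_entropy_words n R} \<le>
          measure_pmf.prob (replicate_pmf n p) (permutations_of_multiset A)"
        by (intro measure_pmf.finite_measure_mono) auto
      also have "\<dots> \<le> exp_decay n (relative_entropy (pmf_of_multiset A) p)"
        using prob_type_class_le[OF A(1)] A(2) by simp
      also have "\<dots> \<le> exp_decay n (exponent_E R p)"
        using False by (intro exp_decay_antimono exponent_E_nonneg)
            (auto simp: exponent_E_def intro!: INF_lower)
      finally show ?thesis .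
    qed
  qed simp
  finally show ?thesis .
qed

subsection \<open>Mutual information and divergence\<close>

lemma set_pmf_joint:
  assumes "\<And>c x. pmf J (c, x) = pmf X x * pmf (W x) c"
  shows "set_pmf J = (\<lambda>(x, c). (c, x)) ` (SIGMA x:set_pmf X. set_pmf (W x))"
  using assms by (force simp: set_pmf_iff)

text \<open>The true output distribution minimises the averaged divergence from the channel outputs, so any
  (sub-)distribution \<open>Q\<close> in its place yields an upper bound on the mutual information.\<close>

lemma mutual_information_le_divergence:
  fixes J :: "('c \<times> 'x) pmf" and W :: "'x \<Rightarrow> 'c pmf" and Q :: "'c \<Rightarrow> real"
  assumes J: "\<And>c x. pmf J (c, x) = pmf X x * pmf (W x) c"
    and X: "map_pmf snd J = X"
    and fin: "finite (set_pmf J)"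
    and Q: "\<And>c. c \<in> set_pmf (map_pmf fst J) \<Longrightarrow> Q c > 0" "sum Q (set_pmf (map_pmf fst J)) \<le> 1"
  shows "(\<Sum>(c, x)\<in>set_pmf J. pmf J (c, x) *
       log 2 (pmf J (c, x) / (pmf (map_pmf fst J) c * pmf (map_pmf snd J) x))) \<le>
    (\<Sum>x\<in>set_pmf X. pmf X x * (\<Sum>c\<in>set_pmf (W x). pmf (W x) c * log 2 (pmf (W x) c / Q c)))"
proof -
  let ?C = "map_pmf fst J"
  have finX: "finite (set_pmf X)" using fin unfolding X[symmetric] by simp
  have finW: "finite (set_pmf (W x))" if "x \<in> set_pmf X" for x
  proof (rule finite_subset)
    show "set_pmf (W x) \<subseteq> fst ` set_pmf J"
    proof
      fix c assume "c \<in> set_pmf (W x)"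
      then have "(c, x) \<in> set_pmf J" using J that by (simp add: set_pmf_iff)
      then show "c \<in> fst ` set_pmf J" by force
    qed
  qed (use fin in simp)
  \<comment> \<open>The logarithm is split as \<open>log 2 (W / Q) + log 2 (Q / C)\<close>, where
    \<open>C\<close> is the output law. The tangent bound on the second part averages to
    \<open>(sum Q - 1) / ln 2\<close>, which is not positive.\<close>
  have "(\<Sum>(c, x)\<in>set_pmf J. pmf J (c, x) *
       log 2 (pmf J (c, x) / (pmf ?C c * pmf (map_pmf snd J) x))) \<le>
    (\<Sum>(c, x)\<in>set_pmf J. pmf J (c, x) * log 2 (pmf (W x) c / Q c)
        + (pmf J (c, x) * (Q c / pmf ?C c) - pmf J (c, x)) / ln 2)"
  proof (intro sum_mono, clarify)
    fix c x assume cx: "(c, x) \<in> set_pmf J"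
    then have "c \<in> set_pmf ?C" by force
    then have pos: "pmf ?C c > 0" "Q c > 0" using Q by (auto simp: pmf_positive_iff)
    have "pmf J (c, x) > 0" using cx by (simp add: pmf_positive_iff)
    then have pos': "pmf X x > 0" "pmf (W x) c > 0" unfolding J by (auto simp: zero_less_mult_iff)
    have "log 2 (pmf J (c, x) / (pmf ?C c * pmf (map_pmf snd J) x)) =
        log 2 (pmf (W x) c / Q c) + log 2 (Q c / pmf ?C c)"
      unfolding X J using pos pos' by (simp add: log_mult log_divide)
    also have "\<dots> \<le> log 2 (pmf (W x) c / Q c) + (Q c / pmf ?C c - 1) / ln 2"
      using pos by (intro add_left_mono log2_le) simp
    finally have "pmf J (c, x) * log 2 (pmf J (c, x) / (pmf ?C c * pmf (map_pmf snd J) x)) \<le>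
      pmf J (c, x) * (log 2 (pmf (W x) c / Q c) + (Q c / pmf ?C c - 1) / ln 2)"
      by (intro mult_left_mono) auto
    then show "pmf J (c, x) * log 2 (pmf J (c, x) / (pmf ?C c * pmf (map_pmf snd J) x)) \<le>
      pmf J (c, x) * log 2 (pmf (W x) c / Q c)
          + (pmf J (c, x) * (Q c / pmf ?C c) - pmf J (c, x)) / ln 2"
      by (simp add: algebra_simps diff_divide_distrib add_divide_distrib)
  qed
  also have "\<dots> = (\<Sum>(c, x)\<in>set_pmf J. pmf J (c, x) * log 2 (pmf (W x) c / Q c)) +
      ((\<Sum>z\<in>set_pmf J. pmf J z * (Q (fst z) / pmf ?C (fst z))) - (\<Sum>z\<in>set_pmf J. pmf J z)) / ln 2"
    by (simp add: split_beta sum.distrib sum_subtractf flip: sum_divide_distrib)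
  also have "(\<Sum>z\<in>set_pmf J. pmf J z) = 1" using fin by (simp add: sum_pmf_eq_1)
  also have "(\<Sum>z\<in>set_pmf J. pmf J z * (Q (fst z) / pmf ?C (fst z))) =
      measure_pmf.expectation J (\<lambda>z. Q (fst z) / pmf ?C (fst z))"
    using fin by (subst integral_measure_pmf[of "set_pmf J"]) auto
  also have "\<dots> = measure_pmf.expectation ?C (\<lambda>c. Q c / pmf ?C c)" by simp
  also have "\<dots> = (\<Sum>c\<in>set_pmf ?C. pmf ?C c * (Q c / pmf ?C c))"
    using fin by (subst integral_measure_pmf[of "set_pmf ?C"]) auto
  also have "\<dots> = sum Q (set_pmf ?C)"
    by (intro sum.cong refl) (simp add: set_pmf_iff del: set_map_pmf)
  also have "(\<Sum>(c, x)\<in>set_pmf J. pmf J (c, x) * log 2 (pmf (W x) c / Q c)) =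
      (\<Sum>(x, c)\<in>(SIGMA x:set_pmf X. set_pmf (W x)). pmf J (c, x) * log 2 (pmf (W x) c / Q c))"
    unfolding set_pmf_joint[OF J]
     by (subst sum.reindex) (auto simp: inj_on_def split_beta)
  also have "\<dots> = (\<Sum>x\<in>set_pmf X. pmf X x * (\<Sum>c\<in>set_pmf (W x). pmf (W x) c * log 2 (pmf (W x) c / Q c)))"
    using finX finW by (subst sum.Sigma[symmetric]) (auto simp: J sum_distrib_left mult.assoc)
  finally show ?thesis
    using Q(2) divide_nonpos_pos[of "sum Q (set_pmf ?C) - 1" "ln 2"] by simp
qed

text \<open>Key and source are independent, so given \<open>x\<close> the ciphertext has the law of
  \<open>\<phi> k x\<close> for random \<open>k\<close>. This is the channel form that
  \<open>mutual_information_le_divergence\<close> expects.\<close>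

lemma pmf_joint_output:
  "pmf (map_pmf (\<lambda>(k, x). (\<phi> k x, x)) (pair_pmf K X)) (c, x)
      = pmf X x * pmf (map_pmf (\<lambda>k. \<phi> k x) K) c"
proof -
  have "map_pmf (\<lambda>(k, x). (\<phi> k x, x)) (pair_pmf K X) =
      bind_pmf X (\<lambda>x. map_pmf (\<lambda>c. (c, x)) (map_pmf (\<lambda>k. \<phi> k x) K))"
    by (simp add: pair_pmf_def map_bind_pmf map_pmf_comp bind_commute_pmf[of K] map_pmf_def[of _ K])
  moreover have "pmf (bind_pmf X (\<lambda>x. map_pmf (\<lambda>c. (c, x)) (map_pmf (\<lambda>k. \<phi> k x) K))) (c, x) =
      (\<Sum>x'\<in>{x}. pmf X x' *\<^sub>R pmf (map_pmf (\<lambda>c. (c, x')) (map_pmf (\<lambda>k. \<phi> k x') K)) (c, x))"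
    unfolding pmf_bind by (rule integral_measure_pmf) (auto simp flip: set_pmf_iff)
  moreover have "pmf (map_pmf (\<lambda>c. (c, x)) (map_pmf (\<lambda>k. \<phi> k x) K)) (c, x)
      = pmf (map_pmf (\<lambda>k. \<phi> k x) K) c"
    by (rule pmf_map_inj') (simp add: inj_def)
  ultimately show ?thesis by simp
qed

lemma finite_set_replicate_pmf [simp]: "finite (set_pmf (replicate_pmf n (p :: 'a::finite pmf)))"
  by (rule finite_subset[OF set_replicate_pmf_subset finite_length_lists])

text \<open>The set \<open>D\<close> may be any finite superset of the possible outputs, so the mass
  of \<open>Q\<close> can be checked on a convenient set instead of the exact range.\<close>

lemma leakage_MI_le:
  fixes \<phi> :: "'a::finite list \<Rightarrow> 'a list \<Rightarrow> bool list" and pX pK :: "'a pmf" and n :: nat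
  defines "W \<equiv> \<lambda>x. map_pmf (\<lambda>k. \<phi> k x) (replicate_pmf n pK)"
  assumes D: "finite D" "\<And>x. x \<in> set_pmf (replicate_pmf n pX) \<Longrightarrow> set_pmf (W x) \<subseteq> D"
    and Q: "\<And>c. 0 \<le> Q c" "\<And>x c. x \<in> set_pmf (replicate_pmf n pX) \<Longrightarrow> c \<in> set_pmf (W x) \<Longrightarrow> Q c > 0" "sum Q D
        \<le> 1"
  shows "leakage_MI n \<phi> pX pK \<le> (\<Sum>x\<in>set_pmf (replicate_pmf n pX). pmf (replicate_pmf n pX) x *
     (\<Sum>c\<in>set_pmf (W x). pmf (W x) c * log 2 (pmf (W x) c / Q c)))"
  unfolding leakage_MI_eq
proof (rule mutual_information_le_divergence)
  let ?J = "map_pmf (\<lambda>(k, x). (\<phi> k x, x)) (key_source_pmf n pX pK)"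
  show "pmf ?J (c, x) = pmf (replicate_pmf n pX) x * pmf (W x) c" for c x
    by (simp add: key_source_pmf_def W_def pmf_joint_output)
  have "map_pmf snd ?J = map_pmf snd (key_source_pmf n pX pK)"
    by (simp add: map_pmf_comp split_beta)
  then show "map_pmf snd ?J = replicate_pmf n pX" by (simp add: key_source_pmf_def map_snd_pair_pmf)
  show "finite (set_pmf ?J)" by (simp add: key_source_pmf_def)
  have out: "\<exists>x\<in>set_pmf (replicate_pmf n pX). c \<in> set_pmf (W x)" if "c \<in> set_pmf (map_pmf fst ?J)" for c
    using that by (fastforce simp: key_source_pmf_def W_def)
  then show "Q c > 0" if "c \<in> set_pmf (map_pmf fst ?J)" for c using Q(2) that by blast
  have "sum Q (set_pmf (map_pmf fst ?J)) \<le> sum Q D"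
    using out D Q(1) by (intro sum_mono2) blast+
  then show "sum Q (set_pmf (map_pmf fst ?J)) \<le> 1" using Q(3) by simp
qed

section \<open>Divergence of the reduced key from uniform\<close>

text \<open>Given its type the key is uniform on the type class, and convexity of \<open>t log t\<close>, applied through
  its tangents, reduces the divergence from the uniform law on \<open>N\<close> points to single classes.\<close>

lemma hashed_key_divergence_le:
  fixes h :: "'a::finite list \<Rightarrow> 'c" and p :: "'a pmf" and n :: nat
  defines "W \<equiv> map_pmf h (replicate_pmf n p)"
  assumes N: "N \<ge> (1 :: real)" and n: "n > 0"
    and fibre: "\<And>A c. A \<in> types_of_length n \<Longrightarrow>
      card {k \<in> permutations_of_multiset A. h k = c} \<le> card (permutations_of_multiset A) / N + 1"
  shows "(\<Sum>c\<in>set_pmf W. pmf W c * log 2 (N * pmf W c)) \<le>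
    (\<Sum>A\<in>types_of_length n. measure_pmf.prob (replicate_pmf n p) (permutations_of_multiset A) *
       min (log 2 N) (N / card (permutations_of_multiset A) / ln 2))"
proof -
  let ?K = "replicate_pmf n p" and ?T = permutations_of_multiset
  \<comment> \<open>\<open>w A\<close> is the probability that the key has type \<open>A\<close>,
    \<open>V A\<close> the law of \<open>h\<close> on that class, and \<open>\<beta> A\<close> the
    bound on the divergence of \<open>V A\<close> from uniform.\<close>
  define w where "w = (\<lambda>A. measure_pmf.prob ?K (?T A))"
  define V where "V = (\<lambda>A c. card {k \<in> ?T A. h k = c} / card (?T A))"
  define \<beta> where "\<beta> = (\<lambda>A :: 'a multiset. min (log 2 N) (N / card (?T A) / ln 2))"
  have M: "real (card (?T A)) > 0" for A :: "'a multiset" by (simp add: card_gt_0_iff)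
  have w0: "w A \<ge> 0" for A by (simp add: w_def)
  have V0: "V A c \<ge> 0" for A c by (simp add: V_def)
  have \<beta>0: "\<beta> A \<ge> 0" for A using N by (simp add: \<beta>_def)
  have w1: "(\<Sum>A\<in>types_of_length n. w A) = 1" unfolding w_def by (rule sum_prob_types)
  have W_eq: "pmf W c = (\<Sum>A\<in>types_of_length n. w A * V A c)" for c
  proof -
    have "pmf W c = measure_pmf.prob ?K {k. h k = c}" by (simp add: W_def pmf_map vimage_def)
    also have "\<dots> = (\<Sum>A\<in>types_of_length n. measure_pmf.prob ?K {k \<in> ?T A. h k = c})"
      by (rule prob_eq_sum_types)
    also have "\<dots> = (\<Sum>A\<in>types_of_length n. w A * V A c)"
    proof (intro sum.cong refl)
      fix A :: "'a multiset" assume "A \<in> types_of_length n"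
      then have A: "A \<noteq> {#}" "size A = n" using n by (auto simp: types_of_length_def)
      define u where "u = exp_decay n (ereal (shannon_entropy (pmf_of_multiset A))
          + relative_entropy (pmf_of_multiset A) p)"
      have u: "pmf ?K k = u" if "k \<in> ?T A" for k
        using pmf_replicate_type[OF A(1) permutations_of_multisetD[OF that]] A(2) by (simp add: u_def)
      have "measure_pmf.prob ?K {k \<in> ?T A. h k = c} = card {k \<in> ?T A. h k = c} * u"
        using u by (simp add: measure_measure_pmf_finite)
      moreover have "w A = card (?T A) * u" using u by (simp add: w_def measure_measure_pmf_finite)
      ultimately show "measure_pmf.prob ?K {k \<in> ?T A. h k = c} = w A * V A c"
          using M[of A] by (simp add: V_def)
    qed
    finally show ?thesis .
  qed
  \<comment> \<open>The two arguments of the minimum in \<open>\<beta>\<close>: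
    \<open>V A c \<le> 1\<close> yields \<open>log 2 N\<close>, and the fibre bound yields
    \<open>N * V A c \<le> 1 + N / card (?T A)\<close>.\<close>
  have V_log: "V A c * log 2 (N * V A c) \<le> V A c * \<beta> A" if A: "A \<in> types_of_length n" for A c
  proof (cases "V A c = 0")
    case False
    then have pos: "V A c > 0" using V0[of A c] by linarith
    have "card {k \<in> ?T A. h k = c} \<le> card (?T A)" by (intro card_mono) auto
    then have V1: "V A c \<le> 1" using M[of A] by (simp add: V_def)
    have "V A c \<le> (card (?T A) / N + 1) / card (?T A)"
      unfolding V_def using fibre[OF A] by (intro divide_right_mono) auto
    then have "N * V A c \<le> N * ((card (?T A) / N + 1) / card (?T A))"
      using N by (intro mult_left_mono) auto
    also have "\<dots> = 1 + N / card (?T A)" using N M[of A] by (simp add: field_simps)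
    finally have V2: "N * V A c - 1 \<le> N / card (?T A)" by simp
    have "log 2 (N * V A c) \<le> (N * V A c - 1) / ln 2" using pos N by (intro log2_le) simp
    also have "\<dots> \<le> N / card (?T A) / ln 2" by (intro divide_right_mono V2) simp
    finally have "log 2 (N * V A c) \<le> N / card (?T A) / ln 2" .
    moreover have "log 2 (N * V A c) \<le> log 2 N" using pos N V1 by simp
    ultimately show ?thesis using pos by (simp add: \<beta>_def)
  qed simp
  have W_log: "pmf W c * log 2 (N * pmf W c) \<le> (\<Sum>A\<in>types_of_length n. w A * \<beta> A * V A c)"
    if c: "c \<in> set_pmf W" for c
  proof -
    have pos: "pmf W c > 0" using c by (simp add: pmf_positive_iff)
    \<comment> \<open>The correction \<open>(pmf W c - V A c) / ln 2\<close> vanishes when averaged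
      with the weights \<open>w A\<close>, because \<open>W\<close> is the mixture of the
      \<open>V A\<close>.\<close>
    have tangent: "V A c * log 2 (N * pmf W c) \<le> V A c * \<beta> A + (pmf W c - V A c) / ln 2"
      if A: "A \<in> types_of_length n" for A
    proof (cases "V A c = 0")
      case False
      then have posV: "V A c > 0" using V0[of A c] by linarith
      have "log 2 (N * pmf W c) = log 2 (N * V A c) + log 2 (pmf W c / V A c)"
        using pos posV N by (simp add: log_mult log_divide)
      also have "\<dots> \<le> log 2 (N * V A c) + (pmf W c / V A c - 1) / ln 2"
        using pos posV by (intro add_left_mono log2_le) simp
      finally have "V A c * log 2 (N * pmf W c)
          \<le> V A c * (log 2 (N * V A c) + (pmf W c / V A c - 1) / ln 2)"
        using posV by (intro mult_left_mono) auto
      also have "\<dots> = V A c * log 2 (N * V A c) + (pmf W c - V A c) / ln 2"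
        using posV by (simp add: field_simps)
      finally show ?thesis using V_log[OF A, of c] by linarith
    qed (use pos in simp)
    have "pmf W c * log 2 (N * pmf W c) = (\<Sum>A\<in>types_of_length n. w A * V A c) * log 2 (N * pmf W c)"
      by (simp only: W_eq)
    also have "\<dots> = (\<Sum>A\<in>types_of_length n. w A * (V A c * log 2 (N * pmf W c)))"
      by (simp add: sum_distrib_right mult.assoc)
    also have "\<dots> \<le> (\<Sum>A\<in>types_of_length n. w A * (V A c * \<beta> A + (pmf W c - V A c) / ln 2))"
      by (intro sum_mono mult_left_mono tangent w0)
    also have "\<dots> = (\<Sum>A\<in>types_of_length n. w A * \<beta> A * V A c + (w A * pmf W c - w A * V A c) / ln 2)"
      by (intro sum.cong refl) (simp add: algebra_simps diff_divide_distrib)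
    also have "\<dots> = (\<Sum>A\<in>types_of_length n. w A * \<beta> A * V A c) +
        ((\<Sum>A\<in>types_of_length n. w A) * pmf W c - (\<Sum>A\<in>types_of_length n. w A * V A c)) / ln 2"
      by (simp add: sum.distrib sum_subtractf sum_distrib_right flip: sum_divide_distrib)
    finally show ?thesis using w1 W_eq[of c] by simp
  qed
  \<comment> \<open>Only an inequality: a class of probability 0 may have images outside
    \<open>set_pmf W\<close>.\<close>
  have V_sum: "(\<Sum>c\<in>set_pmf W. V A c) \<le> 1" for A
  proof -
    have fin: "finite (set_pmf W)" by (simp add: W_def)
    have "(\<Sum>c\<in>set_pmf W. card {k \<in> ?T A. h k = c}) = card (\<Union>c\<in>set_pmf W. {k \<in> ?T A. h k = c})"
      using fin by (intro card_UN_disjoint[symmetric]) auto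
    also have "\<dots> \<le> card (?T A)" by (intro card_mono) auto
    finally have "(\<Sum>c\<in>set_pmf W. real (card {k \<in> ?T A. h k = c})) \<le> card (?T A)"
      by (metis of_nat_le_iff of_nat_sum)
    then show ?thesis using M[of A] by (simp add: V_def flip: sum_divide_distrib)
  qed
  have "(\<Sum>c\<in>set_pmf W. pmf W c * log 2 (N * pmf W c)) \<le>
      (\<Sum>c\<in>set_pmf W. \<Sum>A\<in>types_of_length n. w A * \<beta> A * V A c)"
    by (intro sum_mono W_log)
  also have "\<dots> = (\<Sum>A\<in>types_of_length n. w A * \<beta> A * (\<Sum>c\<in>set_pmf W. V A c))"
    by (subst sum.swap) (simp add: sum_distrib_left)
  also have "\<dots> \<le> (\<Sum>A\<in>types_of_length n. w A * \<beta> A * 1)"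
    by (intro sum_mono mult_left_mono V_sum mult_nonneg_nonneg w0 \<beta>0)
  finally show ?thesis by (simp add: w_def \<beta>_def)
qed

text \<open>For types with entropy below \<open>R\<close> the positive part in
  \<open>exponent_F\<close> vanishes and \<open>log 2 N\<close> suffices. For the others
  \<open>N / card\<close> decays like \<open>2 powr (- (n * (H - R)))\<close>, which supplies the
  positive part. With \<open>B = (n + 1) ^ CARD('a)\<close>, one power of \<open>B\<close> comes
  from the sum over types and, in the second case, one each from \<open>N\<close> and from the class
  size; the rest is slack up to \<open>B ^ 4\<close>.\<close>

lemma hashed_key_rate_le:
  fixes p :: "'a::finite pmf" and n :: nat and R N :: real
  assumes n: "n > 0" and q: "CARD('a) \<ge> 2" and R: "R > 0"
    and N: "N \<ge> 1" "N \<le> (real n + 1) ^ CARD('a) * 2 powr (n * R)"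
  shows "(\<Sum>A\<in>types_of_length n. measure_pmf.prob (replicate_pmf n p) (permutations_of_multiset A) *
       min (log 2 N) (N / card (permutations_of_multiset A) / ln 2)) \<le>
    (R + gamma_rate CARD('a) n + 1) * CARD('a) * (real n + 1) ^ (4 * CARD('a))
        * exp_decay n (exponent_F R p)"
proof -
  let ?q = "real CARD('a)" and ?T = permutations_of_multiset
  define B where "B = (real n + 1) ^ CARD('a)"
  define r where "r = R + gamma_rate CARD('a) n"
  define e where "e = exp_decay n (exponent_F R p)"
  have "(real n + 1) ^ 1 \<le> B" unfolding B_def using q by (intro power_increasing) auto
  then have B: "real n \<le> B" "1 \<le> B" by auto
  have B_pow: "B ^ 2 \<le> B ^ 3" "B \<le> B ^ 3"
    using power_increasing[of 2 3 B] power_increasing[of 1 3 B] B by auto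
  have r0: "r \<ge> 0" unfolding r_def gamma_rate_def using R q by (intro add_nonneg_nonneg divide_nonneg_nonneg mult_nonneg_nonneg) auto
  have e0: "e \<ge> 0" by (simp add: e_def)
  have logN: "log 2 N \<le> n * r"
  proof -
    have "log 2 N \<le> log 2 ((real n + 1) ^ CARD('a) * 2 powr (n * R))" using N by simp
    also have "\<dots> = ?q * log 2 (real n + 1) + n * R" by (simp add: log_mult log_nat_power)
    also have "\<dots> \<le> n * r" using n q by (simp add: r_def gamma_rate_def field_simps)
    finally show ?thesis .
  qed
  have "measure_pmf.prob (replicate_pmf n p) (?T A) * min (log 2 N) (N / card (?T A) / ln 2) \<le>
      (r + 1) * ?q * B ^ 3 * e" if A_in: "A \<in> types_of_length n" for A
  proof -
    have A: "A \<noteq> {#}" "size A = n" using A_in n by (auto simp: types_of_length_def)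
    let ?H = "shannon_entropy (pmf_of_multiset A)" and ?D = "relative_entropy (pmf_of_multiset A) p"
    have M: "real (card (?T A)) > 0" by (simp add: card_gt_0_iff)
    have w: "measure_pmf.prob (replicate_pmf n p) (?T A) \<le> exp_decay n ?D"
      using prob_type_class_le[OF A(1)] A(2) by simp
    have "exponent_F R p \<le> ereal (max 0 (?H - R)) + ?D"
      unfolding exponent_F_def by (rule INF_lower) simp
    then have "exp_decay n (ereal (max 0 (?H - R)) + ?D) \<le> e"
      unfolding e_def by (intro exp_decay_antimono exponent_F_nonneg)
    then have ed: "2 powr (- (n * max 0 (?H - R))) * exp_decay n ?D \<le> e"
      by (simp only: exp_decay_add[OF relative_entropy_nonneg])
    show ?thesis
    proof (cases "?H < R")
      case True
      have "measure_pmf.prob (replicate_pmf n p) (?T A)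
          * min (log 2 N) (N / card (?T A) / ln 2) \<le> e * (n * r)"
        using w ed True logN N e0 by (intro mult_mono) auto
      also have "\<dots> \<le> e * (B ^ 3 * ((r + 1) * ?q))"
      proof (intro mult_left_mono mult_mono e0)
        have "r * 1 \<le> (r + 1) * ?q" using r0 q by (intro mult_mono) auto
        then show "r \<le> (r + 1) * ?q" by simp
      qed (use B B_pow r0 in auto)
      finally show ?thesis by (simp add: mult_ac)
    next
      case False
      have "2 powr (n * ?H) \<le> B * card (?T A)"
        using card_type_class_ge[OF A(1)] A(2) by (simp add: B_def)
      then have "N * 2 powr (n * ?H) \<le> (B * 2 powr (n * R)) * (B * card (?T A))"
        using N by (intro mult_mono) (auto simp: B_def)
      then have "N / card (?T A) \<le> B ^ 2 * 2 powr (n * R) / 2 powr (n * ?H)"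
        using M by (simp add: field_simps power2_eq_square)
      also have "\<dots> = B ^ 2 * 2 powr (- (n * (?H - R)))"
        by (simp add: right_diff_distrib powr_diff flip: powr_minus)
      finally have NM: "N / card (?T A) \<le> B ^ 2 * 2 powr (- (n * (?H - R)))" .
      \<comment> \<open>The constant \<open>1 / ln 2\<close> is absorbed by
        \<open>CARD('a) \<ge> 2\<close>.\<close>
      have ln2: "1 / ln 2 \<le> (2 :: real)" using ln2_ge_two_thirds by (simp add: field_simps)
      have "min (log 2 N) (N / card (?T A) / ln 2) \<le> N / card (?T A) / ln 2" by simp
      also have "\<dots> \<le> B ^ 2 * 2 powr (- (n * (?H - R))) / ln 2"
          using NM by (intro divide_right_mono) auto
      finally have "measure_pmf.prob (replicate_pmf n p) (?T A)
          * min (log 2 N) (N / card (?T A) / ln 2) \<le>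
          exp_decay n ?D * (B ^ 2 * 2 powr (- (n * (?H - R))) / ln 2)"
        using w N by (intro mult_mono) auto
      also have "\<dots> = (2 powr (- (n * max 0 (?H - R))) * exp_decay n ?D) * (B ^ 2 * (1 / ln 2))"
        using False by (simp add: max_def)
      also have "\<dots> \<le> e * (B ^ 3 * ((r + 1) * ?q))"
      proof (intro mult_mono ed B_pow)
        have "1 * 2 \<le> (r + 1) * ?q" using r0 q by (intro mult_mono) auto
        then show "1 / ln 2 \<le> (r + 1) * ?q" using ln2 by simp
      qed (use e0 B r0 in auto)
      finally show ?thesis by (simp add: mult_ac)
    qed
  qed
  then have "(\<Sum>A\<in>types_of_length n. measure_pmf.prob (replicate_pmf n p) (?T A) *
       min (log 2 N) (N / card (?T A) / ln 2)) \<le> B * ((r + 1) * ?q * B ^ 3 * e)"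
    unfolding B_def using r0 e0 by (intro sum_types_le) auto
  also have "\<dots> = (r + 1) * ?q * B ^ 4 * e"
    by (simp add: power3_eq_cube power4_eq_xxxx mult_ac)
  also have "B ^ 4 = (real n + 1) ^ (4 * CARD('a))"
      by (simp add: B_def mult.commute flip: power_mult)
  finally show ?thesis by (simp add: r_def e_def)
qed

text \<open>The bound \<open>B * 2 powr (-s)\<close> on \<open>p\<close> may exceed 1, where \<open>p - p ln p\<close> is no longer
  increasing; the tangent of \<open>ln\<close> avoids monotonicity.\<close>

lemma error_entropy_le:
  fixes p B s :: real
  assumes "0 \<le> p" "1 \<le> B" "0 \<le> s" "p \<le> B * 2 powr (- s)"
  shows "p / ln 2 - p * log 2 p \<le> (s + 1 / ln 2) * (B * 2 powr (- s))"
proof (cases "p = 0")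
  case False
  then have p: "p > 0" using assms by simp
  define b where "b = B * 2 powr (- s)"
  have b: "b > 0" "p \<le> b" using assms by (auto simp: b_def)
  have "log 2 b = log 2 B - s" using assms by (simp add: b_def log_mult)
  then have "- s \<le> log 2 b" using assms by (simp add: zero_le_log_cancel_iff)
  moreover have "log 2 (b / p) = log 2 b - log 2 p" using p b by (simp add: log_divide)
  moreover have "log 2 (b / p) \<le> (b / p - 1) / ln 2" using p b by (intro log2_le) simp
  ultimately have "- log 2 p \<le> (b / p - 1) / ln 2 + s" by simp
  then have "p * (- log 2 p) \<le> p * ((b / p - 1) / ln 2 + s)" using p by (intro mult_left_mono) auto
  also have "\<dots> = (b - p) / ln 2 + p * s" using p by (simp add: field_simps)
  also have "\<dots> \<le> (b - p) / ln 2 + b * s" using b assms by (intro add_left_mono mult_right_mono) auto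
  finally show ?thesis by (simp add: b_def[symmetric] algebra_simps diff_divide_distrib)
qed (use assms in auto)

section \<open>Leakage of a cipher with a masked and a clear mode\<close>

text \<open>The assumptions isolate what the estimate uses of the cipher: few masked codewords,
  clear codewords free of the key and disjoint from them, and a nearly even spread of each key type
  class over the masked codewords.\<close>

lemma leakage_two_mode_cipher:
  fixes \<phi> :: "'a::finite list \<Rightarrow> 'a list \<Rightarrow> bool list" and pX pK :: "'a pmf" and n :: nat
      and R N :: real
  assumes n: "n > 0" and q: "CARD('a) \<ge> 2" and R: "R > 0"
    and N: "N \<ge> 1" "N \<le> (real n + 1) ^ CARD('a) * 2 powr (n * R)"
    and C: "finite C" "card C \<le> N"
    and low: "\<And>k x. x \<in> low_entropy_words n R \<Longrightarrow> \<phi> k x \<in> C"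
    and high: "\<And>k x. length x = n \<Longrightarrow> x \<notin> low_entropy_words n R \<Longrightarrow> \<phi> k x = plain x"
      "\<And>x. length x = n \<Longrightarrow> plain x \<notin> C"
    and fibre: "\<And>A x c. A \<in> types_of_length n \<Longrightarrow> x \<in> low_entropy_words n R \<Longrightarrow>
      card {k \<in> permutations_of_multiset A. \<phi> k x = c} \<le> card (permutations_of_multiset A) / N + 1"
  shows "leakage_MI n \<phi> pX pK \<le>
    (n * (real_of_ereal (exponent_E R pX) + log 2 CARD('a)) + log 2 (exp 1)) *
       (real n + 1) ^ CARD('a) * exp_decay n (exponent_E R pX) +
    (R + gamma_rate CARD('a) n + 1) * CARD('a) * (real n + 1) ^ (4 * CARD('a))
        * exp_decay n (exponent_F R pK)"
proof -
  let ?X = "replicate_pmf n pX" and ?S = "low_entropy_words n R :: 'a list set"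
  let ?W = "\<lambda>x. map_pmf (\<lambda>k. \<phi> k x) (replicate_pmf n pK)"
  let ?words = "{xs :: 'a list. length xs = n}"
  let ?q = "real CARD('a)"
  define p where "p = measure_pmf.prob ?X (- ?S)"
  define d where "d = (R + gamma_rate CARD('a) n + 1) * CARD('a) * (real n + 1) ^ (4 * CARD('a))
      * exp_decay n (exponent_F R pK)"
  define Q where "Q = (\<lambda>c. if c \<in> C then (1 - p) / N else p / ?q ^ n)"
  \<comment> \<open>The bound on the divergence from \<open>Q\<close> for a single word:
    \<open>d\<close> or \<open>n * log 2 ?q\<close> from the spread within its group, plus the cost
    of naming the group.\<close>
  define g where "g = (\<lambda>x. if x \<in> ?S then d - log 2 (1 - p) else n * log 2 ?q - log 2 p)"
  have p: "0 \<le> p" "p \<le> 1" by (auto simp: p_def)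
  have p': "measure_pmf.prob ?X ?S = 1 - p"
    using measure_pmf.prob_compl[of ?S ?X] by (simp add: p_def Compl_eq_Diff_UNIV)
  have d0: "0 \<le> d" unfolding d_def gamma_rate_def using R q
    by (intro mult_nonneg_nonneg add_nonneg_nonneg divide_nonneg_nonneg) auto
  have len: "length x = n" if "x \<in> set_pmf ?X" for x
    using that set_replicate_pmf_subset by blast
  \<comment> \<open>The group of a word of positive probability has positive mass. Hence
    \<open>Q\<close> is positive on every output that occurs, even if \<open>p\<close> is 0 or
    1.\<close>
  have pos: "if x \<in> ?S then 1 - p > 0 else p > 0" if "x \<in> set_pmf ?X" for x
  proof -
    have "0 < pmf ?X x" using that by (simp add: pmf_positive_iff)
    also have "pmf ?X x = measure_pmf.prob ?X {x}" by (simp add: measure_pmf_single)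
    also have "\<dots> \<le> measure_pmf.prob ?X (if x \<in> ?S then ?S else - ?S)"
      by (intro measure_pmf.finite_measure_mono) auto
    finally show ?thesis using p' by (auto simp: p_def split: if_splits)
  qed
  have W_high: "?W x = return_pmf (plain x)" if "x \<in> set_pmf ?X" "x \<notin> ?S" for x
    using high(1)[OF len[OF that(1)] that(2)] by (simp add: map_pmf_const)
  have "leakage_MI n \<phi> pX pK \<le> (\<Sum>x\<in>set_pmf ?X. pmf ?X x *
     (\<Sum>c\<in>set_pmf (?W x). pmf (?W x) c * log 2 (pmf (?W x) c / Q c)))"
  proof (rule leakage_MI_le)
    show "finite (C \<union> plain ` ?words)" using C by (simp add: finite_length_lists)
    show "set_pmf (?W x) \<subseteq> C \<union> plain ` ?words" if "x \<in> set_pmf ?X" for x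
      using that low W_high[of x] len[of x] by (cases "x \<in> ?S") auto
    show "0 \<le> Q c" for c using p N by (simp add: Q_def)
    show "Q c > 0" if "x \<in> set_pmf ?X" "c \<in> set_pmf (?W x)" for x c
    proof (cases "x \<in> ?S")
      case True
      then have "c \<in> C" using that low by auto
      then show ?thesis using True pos[OF that(1)] N by (simp add: Q_def)
    next
      case False
      then have "c = plain x" using that W_high by simp
      then show ?thesis using False pos[OF that(1)] high(2)[OF len[OF that(1)]] q by (simp add: Q_def)
    qed
    have "sum Q (C \<union> plain ` ?words) = sum Q C + sum Q (plain ` ?words - C)"
      using C finite_length_lists by (subst sum.union_disjoint[symmetric]) (auto intro: sum.cong)
    also have "sum Q C = card C * ((1 - p) / N)" by (simp add: Q_def)
    also have "\<dots> \<le> N * ((1 - p) / N)" using C p N by (intro mult_right_mono) auto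
    also have "\<dots> = 1 - p" using N by simp
    also have "sum Q (plain ` ?words - C) = card (plain ` ?words - C) * (p / ?q ^ n)"
        by (simp add: Q_def)
    also have "\<dots> \<le> real (CARD('a) ^ n) * (p / ?q ^ n)"
    proof (intro mult_right_mono of_nat_mono)
      have "card (plain ` ?words - C) \<le> card (plain ` ?words)"
        using finite_length_lists by (intro card_mono) auto
      also have "\<dots> \<le> card ?words" by (intro card_image_le finite_length_lists)
      finally show "card (plain ` ?words - C) \<le> CARD('a) ^ n" by (simp add: card_length_lists)
    qed (use p in auto)
    also have "\<dots> = p" by simp
    finally show "sum Q (C \<union> plain ` ?words) \<le> 1" by simp
  qed
  also have "\<dots> \<le> (\<Sum>x\<in>set_pmf ?X. pmf ?X x * g x)"
  proof (intro sum_mono mult_left_mono)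
    fix x assume x: "x \<in> set_pmf ?X"
    show "(\<Sum>c\<in>set_pmf (?W x). pmf (?W x) c * log 2 (pmf (?W x) c / Q c)) \<le> g x"
    proof (cases "x \<in> ?S")
      case True
      then have p1: "1 - p > 0" using pos[OF x] by simp
      have "(\<Sum>c\<in>set_pmf (?W x). pmf (?W x) c * log 2 (pmf (?W x) c / Q c)) =
          (\<Sum>c\<in>set_pmf (?W x). pmf (?W x) c * log 2 (N * pmf (?W x) c) - pmf (?W x) c * log 2 (1 - p))"
      proof (intro sum.cong refl)
        fix c assume c: "c \<in> set_pmf (?W x)"
        then have "c \<in> C" using low[OF True] by auto
        moreover have "pmf (?W x) c > 0" using c by (simp add: pmf_positive_iff)
        ultimately have "log 2 (pmf (?W x) c / Q c) = log 2 (N * pmf (?W x) c) - log 2 (1 - p)"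
          using p1 N by (simp add: Q_def log_divide log_mult)
        then show "pmf (?W x) c * log 2 (pmf (?W x) c / Q c) =
          pmf (?W x) c * log 2 (N * pmf (?W x) c) - pmf (?W x) c * log 2 (1 - p)"
          by (simp add: right_diff_distrib)
      qed
      also have "\<dots> = (\<Sum>c\<in>set_pmf (?W x). pmf (?W x) c * log 2 (N * pmf (?W x) c)) - log 2 (1 - p)"
        by (simp add: sum_subtractf sum_pmf_eq_1 flip: sum_distrib_right)
      also have "\<dots> \<le> d - log 2 (1 - p)"
        unfolding d_def using hashed_key_divergence_le[OF N(1) n fibre[OF _ True], where p = pK]
          hashed_key_rate_le[OF n q R N, of pK] by (intro diff_right_mono) linarith
      finally show ?thesis using True by (simp add: g_def)
    next
      case False
      then show ?thesis using pos[OF x] high(2)[OF len[OF x]] W_high[OF x] q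
        by (simp add: g_def Q_def log_divide log_nat_power)
    qed
  qed simp
  also have "\<dots> = measure_pmf.prob ?X ?S * (d - log 2 (1 - p))
      + measure_pmf.prob ?X (- ?S) * (n * log 2 ?q - log 2 p)"
  proof -
    have "(\<Sum>x\<in>set_pmf ?X. pmf ?X x * g x) = measure_pmf.expectation ?X g"
      by (subst integral_measure_pmf[of "set_pmf ?X"]) auto
    also have "\<dots> = measure_pmf.expectation ?X (\<lambda>x. indicator ?S x * (d - log 2 (1 - p))
        + indicator (- ?S) x * (n * log 2 ?q - log 2 p))"
      by (intro Bochner_Integration.integral_cong) (auto simp: g_def)
    finally show ?thesis
      by (simp add: integrable_measure_pmf_finite)
  qed
  also have "\<dots> = (1 - p) * d - (1 - p) * log 2 (1 - p) + n * log 2 ?q * p - p * log 2 p"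
    unfolding p' p_def[symmetric] by (simp add: algebra_simps)
  \<comment> \<open>The constant \<open>log 2 (exp 1) = 1 / ln 2\<close> of the claim arises here,
    from bounding the entropy term of the masked mode by \<open>p / ln 2\<close>.\<close>
  also have "\<dots> \<le> d + p / ln 2 + n * log 2 ?q * p - p * log 2 p"
  proof -
    have "(1 - p) * d \<le> 1 * d" using p d0 by (intro mult_right_mono) auto
    moreover have "- ((1 - p) * log 2 (1 - p)) \<le> p / ln 2"
    proof (cases "p = 1")
      case False
      then have p1: "1 - p > 0" using p by simp
      have "- log 2 (1 - p) = log 2 (1 / (1 - p))" using p1 by (simp add: log_divide)
      also have "\<dots> \<le> (1 / (1 - p) - 1) / ln 2" using p1 by (intro log2_le) simp
      finally have "(1 - p) * - log 2 (1 - p) \<le> (1 - p) * ((1 / (1 - p) - 1) / ln 2)"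
        using p1 by (intro mult_left_mono) auto
      also have "\<dots> = p / ln 2" using p1 by (simp add: field_simps)
      finally show ?thesis by simp
    qed simp
    ultimately show ?thesis by simp
  qed
  also have "\<dots> \<le> (n * (real_of_ereal (exponent_E R pX) + log 2 ?q) + 1 / ln 2) *
       ((real n + 1) ^ CARD('a) * exp_decay n (exponent_E R pX)) + d"
  proof -
    let ?b = "(real n + 1) ^ CARD('a) * exp_decay n (exponent_E R pX)"
    have pb: "p \<le> ?b" unfolding p_def by (rule prob_high_entropy_le[OF n])
    \<comment> \<open>The term with the exponent comes from \<open>- log 2 p\<close> when
      \<open>p\<close> is replaced by its bound. An infinite exponent makes \<open>?b\<close> zero
      and forces \<open>p = 0\<close>.\<close>
    have "p / ln 2 - p * log 2 p \<le> (n * real_of_ereal (exponent_E R pX) + 1 / ln 2) * ?b"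
    proof (cases "exponent_E R pX = \<infinity>")
      case True
      then show ?thesis using pb p by (simp add: exp_decay_def)
    next
      case False
      have "0 \<le> n * real_of_ereal (exponent_E R pX)"
        by (simp add: real_of_ereal_pos exponent_E_nonneg)
      then show ?thesis using False pb p error_entropy_le[of p "(real n + 1) ^ CARD('a)" "n * real_of_ereal (exponent_E R pX)"]
        by (simp add: exp_decay_def)
    qed
    moreover have "n * log 2 ?q * p \<le> n * log 2 ?q * ?b" using pb q by (intro mult_left_mono) auto
    ultimately show ?thesis by (simp add: algebra_simps)
  qed
  finally show ?thesis by (simp add: d_def log_def mult.assoc)
qed

subsection \<open>The cipher\<close>

lemma add_mod_left_cancel_nat: "(a + j) mod N
    = (a + j') mod N \<longleftrightarrow> j mod N = j' mod N" for a j j' N :: nat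
proof (induction j j' rule: linorder_wlog)
  case (le j j')
  then show ?case using mod_eq_dvd_iff_nat[of "a + j" "a + j'" N] mod_eq_dvd_iff_nat[of j j' N] by simp metis
qed auto

text \<open>The value \<open>i\<close> fixes \<open>j mod N\<close>, so \<open>j\<close> is
  determined by \<open>j div N\<close>, which lies in \<open>{..M div N}\<close>.\<close>

lemma card_hash_fibre_le:
  fixes a i N M :: nat
  assumes "N > 0"
  shows "card {j \<in> {0..<M}. (a + j mod N) mod N = i} \<le> M / N + 1"
proof -
  let ?B = "{j \<in> {0..<M}. (a + j mod N) mod N = i}"
  have "inj_on (\<lambda>j. j div N) ?B"
  proof (rule inj_onI)
    fix j j' assume j: "j \<in> ?B" "j' \<in> ?B" and div: "j div N = j' div N"
    then have "(a + j mod N) mod N = (a + j' mod N) mod N" by simp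
    then have "j mod N = j' mod N" by (simp only: add_mod_left_cancel_nat mod_mod_trivial)
    then show "j = j'" using div by (metis div_mult_mod_eq)
  qed
  then have "card ?B \<le> card {..M div N}"
    by (rule card_inj_on_le) (auto intro: div_le_mono)
  then have "real (card ?B) \<le> real (M div N) + 1" by simp
  also have "\<dots> \<le> M / N + 1" by (simp add: of_nat_div_le_of_nat)
  finally show ?thesis .
qed

text \<open>The number of binary digits of \<open>N\<close> for \<open>N \<ge> 1\<close>. Unlike the
  rounded-up logarithm it is 1 at \<open>N = 1\<close>, so codewords are never empty.\<close>

definition code_len :: "nat \<Rightarrow> nat" where
  "code_len N = nat \<lfloor>log 2 N\<rfloor> + 1"

lemma le_power_code_len: "N \<ge> 1 \<Longrightarrow> N \<le> 2 ^ code_len N"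
proof -
  assume N: "N \<ge> 1"
  then have "real N = 2 powr log 2 N" by simp
  also have "\<dots> \<le> 2 powr real (code_len N)"
  proof (rule powr_mono)
    have "0 \<le> log 2 N" using N by simp
    then show "log 2 N \<le> real (code_len N)" unfolding code_len_def by simp linarith
  qed simp
  also have "\<dots> = real (2 ^ code_len N)" by (simp add: powr_realpow)
  finally show ?thesis by (simp only: of_nat_le_iff)
qed

lemma code_len_le: "N \<ge> 1 \<Longrightarrow> real (code_len N) \<le> log 2 N + 1"
  by (simp add: code_len_def of_nat_nat zero_le_log_cancel_iff)

lemma code_len_mono: "1 \<le> M \<Longrightarrow> M \<le> N \<Longrightarrow> code_len M \<le> code_len N"
  by (auto simp: code_len_def intro!: nat_mono floor_mono)

lemma inj_into_bit_strings:
  assumes "finite A" "card A \<le> 2 ^ l"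
  obtains f :: "'x \<Rightarrow> bool list" where "inj_on f A" "\<And>x. x \<in> A \<Longrightarrow> length (f x) = l"
proof -
  have "card A \<le> card {xs :: bool list. length xs = l}" using assms by (simp add: card_length_lists)
  from card_le_inj[OF assms(1) finite_length_lists this] that show thesis by blast
qed

text \<open>Only \<open>R\<close>, the type classes and fixed enumerations enter the construction,
  so it does not depend on the source or key law. The \<open>max\<close> keeps reduction modulo
  \<open>N\<close> meaningful when no word has low entropy.\<close>

lemma two_mode_cipher_exists:
  fixes n :: nat and R :: real
  defines "N \<equiv> max 1 (card (low_entropy_words n R :: 'a::finite list set))"
  obtains \<phi> :: "'a::finite list \<Rightarrow> 'a list \<Rightarrow> bool list" and C plain where
    "\<And>k. inj_on (\<phi> k) {x. length x = n}"
    "finite C" "card C \<le> N"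
    "\<And>c. c \<in> C \<Longrightarrow> length c = code_len N"
    "\<And>x. length x = n \<Longrightarrow> length (plain x) = code_len (CARD('a::finite) ^ n) + 1"
    "\<And>k x. x \<in> low_entropy_words n R \<Longrightarrow> \<phi> k x \<in> C"
    "\<And>k x. length x = n \<Longrightarrow> x \<notin> low_entropy_words n R \<Longrightarrow> \<phi> k x = plain x"
    "\<And>x. length x = n \<Longrightarrow> plain x \<notin> C"
    "\<And>A x c. A \<in> types_of_length n \<Longrightarrow> x \<in> low_entropy_words n R \<Longrightarrow>
      card {k \<in> permutations_of_multiset A. \<phi> k x = c} \<le> card (permutations_of_multiset A) / N + 1"
proof -
  let ?words = "{x :: 'a list. length x = n}" and ?S = "low_entropy_words n R :: 'a list set"
  let ?T = "permutations_of_multiset :: 'a multiset \<Rightarrow> 'a list set"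
  have S_sub: "?S \<subseteq> ?words" by (auto simp: low_entropy_words_def)
  have finS: "finite ?S" by (rule finite_subset[OF S_sub finite_length_lists])
  have N1: "N \<ge> 1" by (simp add: N_def)
  have "card ?S \<le> CARD('a) ^ n"
    using card_mono[OF finite_length_lists S_sub] by (simp add: card_length_lists)
  then have N_le: "N \<le> CARD('a) ^ n" by (simp add: N_def)
  have "card ?S \<le> card {..<N}" by (simp add: N_def)
  from card_le_inj[OF finS finite_lessThan this] obtain f where f: "f ` ?S \<subseteq> {..<N}" "inj_on f ?S" by blast
  have "\<exists>h. bij_betw h (?T A) {0..<card (?T A)}" for A by (rule ex_bij_betw_finite_nat) simp
  then obtain r where r: "\<And>A. bij_betw (r A) (?T A) {0..<card (?T A)}" by metis
  obtain e1 :: "nat \<Rightarrow> bool list" where e1: "inj_on e1 {..<N}" "\<And>i. i \<in> {..<N} \<Longrightarrow> length (e1 i)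
      = code_len N"
    using inj_into_bit_strings[of "{..<N}" "code_len N"] le_power_code_len[OF N1] by auto
  have "card ?words \<le> 2 ^ (code_len (CARD('a) ^ n) + 1)"
    using le_power_code_len[of "CARD('a) ^ n"] by (simp add: card_length_lists)
  then obtain plain :: "'a list \<Rightarrow> bool list" where plain: "inj_on plain ?words"
      "\<And>x. x \<in> ?words \<Longrightarrow> length (plain x) = code_len (CARD('a) ^ n) + 1"
    using inj_into_bit_strings[OF finite_length_lists] by metis
  define C where "C = e1 ` {..<N}"
  \<comment> \<open>For a fixed key, adding its rank permutes the residues, so the cipher can be
    inverted; for a fixed word, the residues are spread nearly evenly as the key runs through a type
    class.\<close>
  define \<phi> where "\<phi> = (\<lambda>k x. if x \<in> ?S then e1 ((f x + r (mset k) k mod N) mod N) else plain x)"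
  have low: "\<phi> k x \<in> C" if "x \<in> ?S" for k x using that N1 by (simp add: \<phi>_def C_def)
  \<comment> \<open>Since \<open>N \<le> CARD('a) ^ n\<close>, the additional bit makes clear
    codewords strictly longer than masked ones.\<close>
  have plain_C: "plain x \<notin> C" if "length x = n" for x
  proof
    assume "plain x \<in> C"
    then have "length (plain x) = code_len N" using e1(2) by (auto simp: C_def)
    then show False using plain(2) that code_len_mono[OF N1 N_le] by simp
  qed
  have inj: "inj_on (\<phi> k) ?words" for k
  proof (rule inj_onI)
    fix x y assume xy: "x \<in> ?words" "y \<in> ?words" and eq: "\<phi> k x = \<phi> k y"
    have "z \<in> ?S \<longleftrightarrow> \<phi> k z \<in> C" if "z \<in> ?words" for z
      using low[of z k] plain_C[of z] that by (cases "z \<in> ?S") (simp_all add: \<phi>_def)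
    then have same: "x \<in> ?S \<longleftrightarrow> y \<in> ?S" using xy eq by simp
    show "x = y"
    proof (cases "x \<in> ?S")
      case True
      define s where "s = r (mset k) k mod N"
      have "e1 ((f x + s) mod N) = e1 ((f y + s) mod N)"
          using eq True same by (simp add: \<phi>_def s_def)
      then have "(f x + s) mod N = (f y + s) mod N"
        by (rule inj_onD[OF e1(1)]) (use N1 in auto)
      then have "f x mod N = f y mod N" by (simp add: add_mod_left_cancel_nat add.commute[of _ s])
      moreover have "f x < N" "f y < N" using f(1) True same by auto
      ultimately show ?thesis using inj_onD[OF f(2)] True same by simp
    next
      case False
      then show ?thesis using eq same xy inj_onD[OF plain(1)] by (simp add: \<phi>_def)
    qed
  qed
  have fibre: "card {k \<in> ?T A. \<phi> k x = c} \<le> card (?T A) / N + 1" if x: "x \<in> ?S" for A x c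
  proof (cases "c \<in> C")
    case False
    then have "{k \<in> ?T A. \<phi> k x = c} = {}" using low[OF x] by auto
    then show ?thesis by (simp only: card.empty) simp
  next
    case True
    then obtain i where i: "i < N" "c = e1 i" by (auto simp: C_def)
    let ?B = "{j \<in> {0..<card (?T A)}. (f x + j mod N) mod N = i}"
    have "card {k \<in> ?T A. \<phi> k x = c} \<le> card ?B"
    proof (rule card_inj_on_le)
      show "inj_on (r A) {k \<in> ?T A. \<phi> k x = c}"
        using r[of A] by (auto simp: bij_betw_def intro: inj_on_subset)
      show "r A ` {k \<in> ?T A. \<phi> k x = c} \<subseteq> ?B"
      proof (rule image_subsetI)
        fix k assume "k \<in> {k \<in> ?T A. \<phi> k x = c}"
        then have k: "k \<in> ?T A" and c: "\<phi> k x = c" by auto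
        have "r A k \<in> {0..<card (?T A)}" using k r[of A] by (auto simp: bij_betw_def)
        moreover have "mset k = A" using k by (rule permutations_of_multisetD)
        with c x i have "e1 ((f x + r A k mod N) mod N) = e1 i" by (simp add: \<phi>_def)
        then have "(f x + r A k mod N) mod N = i"
          by (rule inj_onD[OF e1(1)]) (use N1 i in auto)
        ultimately show "r A k \<in> ?B" by simp
      qed
    qed simp
    then have "real (card {k \<in> ?T A. \<phi> k x = c}) \<le> card ?B" by simp
    also have "\<dots> \<le> card (?T A) / N + 1" using N1 by (intro card_hash_fibre_le) simp
    finally show ?thesis .
  qed
  show thesis
  proof (rule that[of \<phi> C plain])
    show "card C \<le> N" unfolding C_def using card_image_le[of "{..<N}" e1] by simp
  qed (use inj low plain_C plain(2) e1(2) fibre in \<open>auto simp: C_def \<phi>_def\<close>)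
qed

section \<open>Decryption, average length and the final bounds\<close>

text \<open>Decryption inverts the injective map of each key. Strings outside its range get an
  arbitrary word of length \<open>n\<close>, because \<open>encryption_scheme\<close> prescribes the
  length of every decoded non-empty string.\<close>

lemma encryption_scheme_exists:
  assumes "\<And>k. length k = n \<Longrightarrow> inj_on (\<phi> k) {x. length x = n}"
    and "\<And>k x. length k = n \<Longrightarrow> length x = n \<Longrightarrow> \<phi> k x \<noteq> []"
  shows "\<exists>\<psi>. encryption_scheme n \<phi> \<psi>"
proof -
  let ?words = "{x. length x = n}"
  define \<psi> where "\<psi> = (\<lambda>k c. if c \<in> \<phi> k ` ?words then inv_into ?words (\<phi> k) c else replicate n undefined)"
  have "length (\<psi> k c) = n" for k c
    using inv_into_into[of c "\<phi> k" ?words] by (auto simp: \<psi>_def)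
  moreover have "\<psi> k (\<phi> k x) = x" if "length k = n" "length x = n" for k x
    using that inv_into_f_f[OF assms(1)] by (simp add: \<psi>_def)
  ultimately show ?thesis using assms(2) unfolding encryption_scheme_def by blast
qed

lemma avg_length_le:
  fixes \<phi> :: "'a::finite list \<Rightarrow> 'a list \<Rightarrow> bool list" and n :: nat and a b :: real
  assumes "\<And>k x. length x = n \<Longrightarrow> real (length (\<phi> k x)) \<le> a + b * indicator D x"
  shows "avg_length n \<phi> pX pK \<le> a + b * measure_pmf.prob (replicate_pmf n pX) D"
proof -
  let ?M = "key_source_pmf n pX pK"
  have fin: "finite (set_pmf ?M)" by (simp add: key_source_pmf_def)
  have "avg_length n \<phi> pX pK \<le> measure_pmf.expectation ?M (\<lambda>z. a + b * indicator D (snd z))"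
    unfolding avg_length_def
  proof (rule integral_mono_AE)
    show "AE z in ?M. (case z of (k, x) \<Rightarrow> real (length (\<phi> k x))) \<le> a + b * indicator D (snd z)"
      using assms by (auto simp: AE_measure_pmf_iff key_source_pmf_def set_replicate_pmf)
  qed (intro integrable_measure_pmf_finite fin)+
  also have "\<dots> = a + b * measure_pmf.expectation ?M (\<lambda>z. indicator D (snd z))"
    using fin by (simp add: integrable_measure_pmf_finite)
  also have "measure_pmf.expectation ?M (\<lambda>z. indicator D (snd z) :: real)
      = measure_pmf.prob (replicate_pmf n pX) D"
    by (simp add: key_source_pmf_def expectation_pair_pmf_snd[where f = "indicator D"])
  finally show ?thesis .
qed

text \<open>The infimum runs over the empty set. This settles the length bound when its coefficient
  \<open>log 2 CARD('a) - R\<close> is negative.\<close>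

lemma exponent_E_eq_top: "exponent_E R p = \<infinity>" if "log 2 CARD('a) < R" for p :: "'a::finite pmf"
proof -
  have "{P :: 'a pmf. R \<le> shannon_entropy P} = {}"
    using that order.trans[OF _ shannon_entropy_le_log_card] by (auto simp flip: not_less)
  then show ?thesis by (simp add: exponent_E_def top_ereal_def)
qed

lemma block_scheme_exists:
  fixes n :: nat and R :: real
  assumes n: "n > 0" and R: "R > 0" and q: "CARD('a::finite) \<ge> 2"
  shows "\<exists>(\<phi> :: 'a::finite list \<Rightarrow> 'a list \<Rightarrow> bool list) \<psi>. encryption_scheme n \<phi> \<psi> \<and>
    (\<forall>pX pK. avg_length n \<phi> pX pK / n \<le> R + gamma_rate CARD('a) n + 1 / n +
        (log 2 CARD('a) - R) * (real n + 1) ^ CARD('a) * exp_decay n (exponent_E R pX) \<and>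
      leakage_MI n \<phi> pX pK \<le>
        (n * (real_of_ereal (exponent_E R pX) + log 2 CARD('a)) + log 2 (exp 1)) *
          (real n + 1) ^ CARD('a) * exp_decay n (exponent_E R pX) +
        (R + gamma_rate CARD('a) n + 1) * CARD('a) * (real n + 1) ^ (4 * CARD('a)) *
          exp_decay n (exponent_F R pK))"
proof -
  let ?S = "low_entropy_words n R :: 'a list set" and ?q = "real CARD('a)"
  define N where "N = max 1 (card ?S)"
  define r where "r = R + gamma_rate CARD('a) n"
  obtain \<phi> :: "'a list \<Rightarrow> 'a list \<Rightarrow> bool list" and C plain where
    inj: "\<And>k. inj_on (\<phi> k) {x. length x = n}"
    and C: "finite C" "card C \<le> N" "\<And>c. c \<in> C \<Longrightarrow> length c = code_len N"
    and plain: "\<And>x. length x = n \<Longrightarrow> length (plain x) = code_len (CARD('a) ^ n) + 1"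
    and low: "\<And>k x. x \<in> ?S \<Longrightarrow> \<phi> k x \<in> C"
    and high: "\<And>k x. length x = n \<Longrightarrow> x \<notin> ?S \<Longrightarrow> \<phi> k x = plain x" "\<And>x. length x = n \<Longrightarrow> plain x \<notin> C"
    and fibre: "\<And>A x c. A \<in> types_of_length n \<Longrightarrow> x \<in> ?S \<Longrightarrow>
      card {k \<in> permutations_of_multiset A. \<phi> k x = c} \<le> card (permutations_of_multiset A) / N + 1"
    by (rule two_mode_cipher_exists[where 'a = 'a and n = n and R = R, folded N_def]) (rule that)
  \<comment> \<open>This covers the value 1 that \<open>N\<close> takes when \<open>?S\<close> is
    empty.\<close>
  have "1 * 1 \<le> (real n + 1) ^ CARD('a) * 2 powr (n * R)"
    using R by (intro mult_mono one_le_power ge_one_powr_ge_zero) auto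
  then have N: "1 \<le> real N" "N \<le> (real n + 1) ^ CARD('a) * 2 powr (n * R)"
    using card_low_entropy_words_le[OF n, of R, where 'a = 'a] by (auto simp: N_def max_def)
  have nr: "n * r = n * R + ?q * log 2 (real n + 1) + log 2 ?q"
    using n by (simp add: r_def gamma_rate_def field_simps)
  have logq: "1 \<le> log 2 ?q" using q by (simp add: one_le_log_cancel_iff)
  have short: "code_len N \<le> n * r + 1"
  proof -
    have "code_len N \<le> log 2 N + 1" using N by (intro code_len_le) simp
    also have "log 2 N \<le> log 2 ((real n + 1) ^ CARD('a) * 2 powr (n * R))" using N by simp
    also have "\<dots> = ?q * log 2 (real n + 1) + n * R" by (simp add: log_mult log_nat_power)
    finally show ?thesis using nr logq by linarith
  qed
  have long: "code_len (CARD('a) ^ n) + 1 \<le> n * r + 1 + n * (log 2 ?q - R)"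
  proof -
    have "real (code_len (CARD('a) ^ n)) \<le> log 2 (real (CARD('a) ^ n)) + 1"
        by (intro code_len_le) simp
    also have "\<dots> = n * log 2 ?q + 1" by (simp add: log_nat_power)
    finally have "code_len (CARD('a) ^ n) + 1 \<le> n * log 2 ?q + 2" by simp
    \<comment> \<open>Two bits exceed \<open>n * log 2 ?q\<close>, one from rounding and one marking
      the mode. One is the \<open>1\<close> of the claim; the other is covered by the summand
      \<open>log 2 ?q\<close> of \<open>n * r\<close>, which is at least 1.\<close>
    also have "\<dots> \<le> n * log 2 ?q + ?q * log 2 (real n + 1) + log 2 ?q + 1"
    proof -
      have "1 \<le> log 2 (real n + 1)" using n by (simp add: one_le_log_cancel_iff)
      then show ?thesis using logq by (simp add: add_increasing)
    qed
    finally show ?thesis using nr by (simp add: algebra_simps)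
  qed
  obtain \<psi> where "encryption_scheme n \<phi> \<psi>"
  proof -
    have "\<phi> k x \<noteq> []" if "length x = n" for k x
      using that low[of x k] C(3) high(1)[of x k] plain[of x] by (cases "x \<in> ?S") (force simp: code_len_def)+
    then show thesis using encryption_scheme_exists[of n \<phi>] inj that by blast
  qed
  moreover have "avg_length n \<phi> pX pK / n \<le> r + 1 / n +
        (log 2 ?q - R) * (real n + 1) ^ CARD('a) * exp_decay n (exponent_E R pX)" for pX pK
  proof -
    let ?p = "measure_pmf.prob (replicate_pmf n pX) (- ?S)"
    let ?b = "(real n + 1) ^ CARD('a) * exp_decay n (exponent_E R pX)"
    have pb: "?p \<le> ?b" by (rule prob_high_entropy_le[OF n])
    have "avg_length n \<phi> pX pK \<le> (n * r + 1) + n * (log 2 ?q - R) * ?p"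
    proof (rule avg_length_le)
      fix k x :: "'a list" assume "length x = n"
      then show "real (length (\<phi> k x)) \<le> (n * r + 1) + n * (log 2 ?q - R) * indicator (- ?S) x"
        using low[of x k] C(3) high(1)[of x k] plain[of x] short long by (cases "x \<in> ?S") auto
    qed
    also have "\<dots> \<le> (n * r + 1) + n * ((log 2 ?q - R) * ?b)"
    \<comment> \<open>A negative coefficient would reverse the bound on \<open>?p\<close>; in that
      case the exponent is infinite and both \<open>?p\<close> and \<open>?b\<close> are 0.\<close>
    proof (cases "R \<le> log 2 ?q")
      case True
      then show ?thesis using pb by (simp add: mult.assoc mult_left_mono)
    next
      case False
      then have "?b = 0" by (simp add: exponent_E_eq_top exp_decay_def)
      then have "?p = 0" using pb measure_nonneg[of "measure_pmf (replicate_pmf n pX)" "- ?S"] by linarith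
      then show ?thesis using \<open>?b = 0\<close> by simp
    qed
    finally have "avg_length n \<phi> pX pK / n \<le> ((n * r + 1) + n * ((log 2 ?q - R) * ?b)) / n"
      by (rule divide_right_mono) simp
    also have "\<dots> = r + 1 / n + (log 2 ?q - R) * ?b" using n by (simp add: add_divide_distrib)
    finally show ?thesis by (simp add: mult.assoc)
  qed
  moreover have "leakage_MI n \<phi> pX pK \<le>
        (n * (real_of_ereal (exponent_E R pX) + log 2 ?q) + log 2 (exp 1)) *
          (real n + 1) ^ CARD('a) * exp_decay n (exponent_E R pX) +
        (r + 1) * ?q * (real n + 1) ^ (4 * CARD('a)) * exp_decay n (exponent_F R pK)" for pX pK
    unfolding r_def
    by (rule leakage_two_mode_cipher[OF n q R N C(1) _ low, where plain = plain])
       (use C(2) high fibre in auto)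
  ultimately show ?thesis unfolding r_def by blast
qed

theorem theorem1:
  fixes R :: real
  assumes "R > 0"
  shows "\<exists>(\<Phi> :: nat \<Rightarrow> 'a::{field,finite} list \<Rightarrow> 'a list \<Rightarrow> bool list)
          (\<Psi> :: nat \<Rightarrow> 'a list \<Rightarrow> bool list \<Rightarrow> 'a list).
    (\<forall>n\<ge>1. encryption_scheme n (\<Phi> n) (\<Psi> n)) \<and>
    (\<forall>n\<ge>1. \<forall>(pX :: 'a pmf) (pK :: 'a pmf).
       (let q = CARD('a);
            Rn = R + gamma_rate q n;
            E = exponent_E R pX;
            F = exponent_F R pK
        in avg_length n (\<Phi> n) pX pK / real n
             \<le> Rn + 1 / real n + (log 2 (real q) - R) * (real n + 1) ^ q * exp_decay n E
         \<and> leakage_MI n (\<Phi> n) pX pK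
             \<le> (real n * (real_of_ereal E + log 2 (real q)) + log 2 (exp 1))
                   * (real n + 1) ^ q * exp_decay n E
               + (Rn + 1) * real q * (real n + 1) ^ (4 * q) * exp_decay n F))"
proof -
  \<comment> \<open>The distinct field elements 0 and 1 provide the two letters that the constants
    rely on.\<close>
  have "card {0, 1 :: 'a} \<le> CARD('a)" by (intro card_mono) auto
  then have q: "CARD('a) \<ge> 2" by simp
  define good where "good = (\<lambda>n (\<phi> :: 'a list \<Rightarrow> 'a list \<Rightarrow> bool list) \<psi>. encryption_scheme n \<phi> \<psi> \<and>
    (\<forall>pX pK. avg_length n \<phi> pX pK / n \<le> R + gamma_rate CARD('a) n + 1 / n +
        (log 2 CARD('a) - R) * (real n + 1) ^ CARD('a) * exp_decay n (exponent_E R pX) \<and>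
      leakage_MI n \<phi> pX pK \<le>
        (n * (real_of_ereal (exponent_E R pX) + log 2 CARD('a)) + log 2 (exp 1)) *
          (real n + 1) ^ CARD('a) * exp_decay n (exponent_E R pX) +
        (R + gamma_rate CARD('a) n + 1) * CARD('a) * (real n + 1) ^ (4 * CARD('a)) *
          exp_decay n (exponent_F R pK)))"
  have "\<exists>\<phi> \<psi>. good n \<phi> \<psi>" if "n \<ge> 1" for n
    unfolding good_def by (rule block_scheme_exists) (use that assms q in auto)
  \<comment> \<open>The laws are quantified inside \<open>good\<close>, so the chosen sequence is
    independent of them.\<close>
  then obtain \<Phi> \<Psi> where good: "\<And>n. n \<ge> 1 \<Longrightarrow> good n (\<Phi> n) (\<Psi> n)" by metis
  show ?thesis
    unfolding Let_def using good unfolding good_def by blast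
qed

end
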